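(* For a positive real number $\beta$, let $\mathcal{N}_\beta$ be the linear subspace of $L^\infty(\mathbb{R}_+)$ spanned by the functions $x\mapsto e^{i 2m\pi x}$ and $x\mapsto e^{i n\pi\beta/x}$, where $m,n$ range over the integers. If $\beta>2$, then the weak-star closure of $\mathcal{N}_\beta$ in $L^\infty(\mathbb{R}_+)$ has infinite codimension in $L^\infty(\mathbb{R}_+)$.
   Context: $\mathbb{R}_+$ is the positive half-axis. $L^\infty(\mathbb{R}_+)$ is the space of (classes of) essentially bounded complex-valued functions on $\mathbb{R}_+$ with respect to Lebesgue measure; the weak-star topology is the one it carries as the dual of $L^1(\mathbb{R}_+)$ under the bilinear pairing $\langle f,g\rangle=\int_{\mathbb{R}_+}fg\,dx$. The span consists of finite complex linear combinations. *)

theory Defs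
  imports "HOL-Analysis.Analysis"
begin

abbreviation halfline :: "real measure"
  where "halfline \<equiv> lebesgue_on {0<..}"

definition ess_bounded :: "(real \<Rightarrow> complex) \<Rightarrow> bool"
  where "ess_bounded f \<longleftrightarrow>
    f \<in> borel_measurable halfline \<and> (\<exists>C. AE x in halfline. norm (f x) \<le> C)"

definition linf_eq :: "(real \<Rightarrow> complex) \<Rightarrow> (real \<Rightarrow> complex) \<Rightarrow> bool"
  where "linf_eq f g \<longleftrightarrow> ess_bounded f \<and> ess_bounded g \<and> (AE x in halfline. f x = g x)"

lemma ess_bounded_bounded:
  assumes "f \<in> borel_measurable halfline" "\<And>x. norm (f x) \<le> C"
  shows "ess_bounded f"
  using assms by (auto simp: ess_bounded_def)

lemma ess_bounded_add:
  assumes "ess_bounded f" "ess_bounded g"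
  shows "ess_bounded (\<lambda>x. f x + g x)"
proof -
  obtain C D where "AE x in halfline. norm (f x) \<le> C" "AE x in halfline. norm (g x) \<le> D"
    using assms by (auto simp: ess_bounded_def)
  then have "AE x in halfline. norm (f x + g x) \<le> C + D"
    by eventually_elim (metis add_mono norm_triangle_le)
  then show ?thesis
    using assms by (auto simp: ess_bounded_def)
qed

lemma ess_bounded_mult_const:
  assumes "ess_bounded f"
  shows "ess_bounded (\<lambda>x. c * f x)"
proof -
  obtain C where "AE x in halfline. norm (f x) \<le> C"
    using assms by (auto simp: ess_bounded_def)
  then have "AE x in halfline. norm (c * f x) \<le> norm c * C"
    by eventually_elim (simp add: norm_mult mult_left_mono)
  then show ?thesis
    using assms by (auto simp: ess_bounded_def)
qed

lemma ess_bounded_uminus: "ess_bounded f \<Longrightarrow> ess_bounded (\<lambda>x. - f x)"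
  using ess_bounded_mult_const[of f "-1"] by simp

lemma part_equivp_linf_eq: "part_equivp linf_eq"
proof (rule part_equivpI)
  have "linf_eq (\<lambda>x. 0) (\<lambda>x. 0)"
    by (auto simp: linf_eq_def intro: ess_bounded_bounded[of _ 0])
  then show "\<exists>f. linf_eq f f" by blast
  show "symp linf_eq"
    by (auto simp: symp_def linf_eq_def)
  show "transp linf_eq"
    by (auto simp: transp_def linf_eq_def elim: eventually_elim2)
qed

quotient_type linf = "real \<Rightarrow> complex" / partial: linf_eq
  by (rule part_equivp_linf_eq)

instantiation linf :: ab_group_add
begin

lift_definition zero_linf :: linf is "\<lambda>x. 0"
  by (auto simp: linf_eq_def intro: ess_bounded_bounded[of _ 0])

lift_definition plus_linf :: "linf \<Rightarrow> linf \<Rightarrow> linf" is "\<lambda>f g x. f x + g x"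
  by (auto simp: linf_eq_def intro: ess_bounded_add elim: eventually_elim2)

lift_definition uminus_linf :: "linf \<Rightarrow> linf" is "\<lambda>f x. - f x"
  by (auto simp: linf_eq_def intro: ess_bounded_uminus)

definition minus_linf :: "linf \<Rightarrow> linf \<Rightarrow> linf"
  where "minus_linf f g = f + - g"

instance
proof
  fix a b c :: linf
  show "a + b + c = a + (b + c)"
    by transfer (auto simp: linf_eq_def add.assoc intro!: ess_bounded_add)
  show "a + b = b + a"
    by transfer (auto simp: linf_eq_def add.commute intro!: ess_bounded_add)
  show "0 + a = a"
    by transfer (auto simp: linf_eq_def)
  show "- a + a = 0"
    by transfer (auto simp: linf_eq_def intro: ess_bounded_bounded[of _ 0])
  show "a - b = a + - b"
    by (rule minus_linf_def)
qed

end

lift_definition linf_scale :: "complex \<Rightarrow> linf \<Rightarrow> linf" is "\<lambda>c f x. c * f x"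
  by (auto simp: linf_eq_def intro: ess_bounded_mult_const)

global_interpretation linf: vector_space linf_scale
proof
  fix a b :: complex and f g :: linf
  show "linf_scale a (f + g) = linf_scale a f + linf_scale a g"
    by transfer (auto simp: linf_eq_def distrib_left intro!: ess_bounded_add ess_bounded_mult_const)
  show "linf_scale (a + b) f = linf_scale a f + linf_scale b f"
    by transfer (auto simp: linf_eq_def distrib_right intro!: ess_bounded_add ess_bounded_mult_const)
  show "linf_scale a (linf_scale b f) = linf_scale (a * b) f"
    by transfer (auto simp: linf_eq_def mult.assoc intro!: ess_bounded_mult_const)
  show "linf_scale 1 f = f"
    by transfer (auto simp: linf_eq_def)
qed

text \<open>The guard only serves to make the pairing total in the second argument; the
  pairing is used for integrable \<open>g\<close> alone.\<close>

lift_definition linf_pairing :: "linf \<Rightarrow> (real \<Rightarrow> complex) \<Rightarrow> complex"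
  is "\<lambda>f g. if integrable halfline g then LINT x|halfline. f x * g x else 0"
proof (rule ext)
  fix f f' g :: "real \<Rightarrow> complex"
  assume "linf_eq f f'"
  then have "integrable halfline g \<Longrightarrow>
      (LINT x|halfline. f x * g x) = (LINT x|halfline. f' x * g x)"
    by (intro integral_cong_AE)
       (auto simp: linf_eq_def ess_bounded_def elim: eventually_mono)
  then show "(if integrable halfline g then LINT x|halfline. f x * g x else 0) =
      (if integrable halfline g then LINT x|halfline. f' x * g x else 0)"
    by simp
qed

text \<open>The coarsest topology for which all functionals induced by \<open>L\<^sup>1\<close> functions are
  continuous. Using \<open>L\<^sup>1\<close> functions instead of their classes gives the same functionals.\<close>

definition weak_star :: "linf topology"
  where "weak_star = topology_generated_by
    {{f. linf_pairing f g \<in> U} | g U. integrable halfline g \<and> open U}"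

lemma topspace_weak_star: "topspace weak_star = UNIV"
proof -
  have "f \<in> \<Union> {{f. linf_pairing f g \<in> U} | g U. integrable halfline g \<and> open U}" for f
  proof (rule UnionI)
    show "{f. linf_pairing f (\<lambda>x. 0) \<in> UNIV} \<in>
        {{f. linf_pairing f g \<in> U} | g U. integrable halfline g \<and> open U}"
      by (rule CollectI, rule exI[of _ "\<lambda>x. 0"], rule exI[of _ UNIV]) simp
  qed simp
  then show ?thesis
    unfolding weak_star_def topology_generated_by_topspace by (rule UNIV_eq_I[symmetric])
qed

lift_definition exp_lin :: "int \<Rightarrow> linf"
  is "\<lambda>m x. exp (\<i> * 2 * of_int m * of_real pi * of_real x)"
proof -
  fix m :: int
  have "continuous_on {0<..} (\<lambda>x::real. exp (\<i> * 2 * of_int m * of_real pi * of_real x))"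
    by (intro continuous_intros)
  then have "(\<lambda>x::real. exp (\<i> * 2 * of_int m * of_real pi * of_real x)) \<in> borel_measurable halfline"
    by (rule continuous_imp_measurable_on_sets_lebesgue) auto
  then show "linf_eq (\<lambda>x. exp (\<i> * 2 * of_int m * of_real pi * of_real x))
      (\<lambda>x. exp (\<i> * 2 * of_int m * of_real pi * of_real x))"
    by (auto simp: linf_eq_def intro: ess_bounded_bounded[of _ 1])
qed

lift_definition exp_inv :: "real \<Rightarrow> int \<Rightarrow> linf"
  is "\<lambda>\<beta> n x. exp (\<i> * of_int n * of_real pi * of_real \<beta> / of_real x)"
proof -
  fix \<beta> :: real and n :: int
  have "continuous_on {0<..} (\<lambda>x::real. exp (\<i> * of_int n * of_real pi * of_real \<beta> / of_real x))"
    by (intro continuous_intros) auto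
  then have "(\<lambda>x::real. exp (\<i> * of_int n * of_real pi * of_real \<beta> / of_real x)) \<in> borel_measurable halfline"
    by (rule continuous_imp_measurable_on_sets_lebesgue) auto
  then show "linf_eq (\<lambda>x. exp (\<i> * of_int n * of_real pi * of_real \<beta> / of_real x))
      (\<lambda>x. exp (\<i> * of_int n * of_real pi * of_real \<beta> / of_real x))"
    by (auto simp: linf_eq_def intro: ess_bounded_bounded[of _ 1])
qed

definition N_space :: "real \<Rightarrow> linf set"
  where "N_space \<beta> = linf.span (range exp_lin \<union> range (exp_inv \<beta>))"

text \<open>The quotient of \<open>L\<^sup>\<infinity>\<close> by \<open>S\<close> is not spanned by the cosets of finitely many
  elements; \<open>f - g \<in> S\<close> says that \<open>f\<close> and \<open>g\<close> have the same coset. Meant for subspaces \<open>S\<close>.\<close>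

definition infinite_codimension :: "linf set \<Rightarrow> bool"
  where "infinite_codimension S \<longleftrightarrow>
    \<not> (\<exists>B. finite B \<and> (\<forall>f. \<exists>g\<in>linf.span B. f - g \<in> S))"

end

theory Submission imports Defs begin

text \<open>
  Put \<open>\<gamma> = \<beta> / 2 > 1\<close>. A compactly supported density \<open>g\<close> on the half-line annihilates all
  \<open>e\<^sup>2\<^sup>\<pi>\<^sup>i\<^sup>m\<^sup>x\<close> iff its periodization vanishes, and the exponentials in \<open>1 / x\<close> are the images of
  those in \<open>x\<close> under \<open>x \<mapsto> \<gamma> / x\<close>. So if \<open>g\<close> is antisymmetric under the action of this
  involution on densities, one condition suffices. Choose \<open>b > 1\<close> with \<open>b\<^sup>2 < \<gamma>\<close> and look for
  \<open>g = A - A\<^sup>#\<close>, where \<open>#\<close> is the action of the involution and \<open>A = \<psi> p + e\<close> with \<open>p\<close>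
  periodic, \<open>\<psi>\<close> a cut-off supported in \<open>[a, b]\<close> whose translates add up to 1, and \<open>e\<close> a free
  bump supported in \<open>[\<surd>\<gamma>, \<gamma> / b]\<close>. The condition becomes \<open>p - Q p = w\<close>, where \<open>w\<close> is
  determined by \<open>e\<close> and \<open>Q\<close> is a smoothed transfer operator of the Gauss-type map
  \<open>x \<mapsto> \<gamma> / x\<close> modulo 1. Since this map is expanding, \<open>Q\<close> satisfies a Lasota--Yorke inequality:
  it contracts the total variation by \<open>b\<^sup>2 / \<gamma>\<close> up to a multiple of the \<open>L\<^sup>1\<close> norm. Precomposing
  \<open>Q\<^sup>n\<close> with the error of a fine interpolation gives a strict contraction, so \<open>1 - Q\<^sup>n\<close> is
  invertible up to a finite-rank error, and \<open>p - Q p = w\<close> is solvable under finitely many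
  linear conditions on \<open>w\<close>. As \<open>g = e\<close> on \<open>[\<surd>\<gamma>, \<gamma> / b]\<close>, infinitely many disjoint bumps produce
  infinitely many independent annihilators.
\<close>

section \<open>Integrals over the line\<close>

text \<open>The blocks start at -1 and number \<open>J + 1\<close> to match the summands of
  \<open>peri\<close>, so that integrals over the line turn into integrals of
  periodizations.\<close>

lemma integral_unit_blocks:
  fixes f :: "real \<Rightarrow> 'a::euclidean_space"
  assumes "continuous_on UNIV f"
  shows "integral {-1..real J} f = (\<Sum>j\<le>J. integral {0..1} (\<lambda>y. f (y - 1 + real j)))"
proof (induction J)
  case 0
  show ?case using integral_shift_real_ivl[of "-1" "-1" 0 f] by simp
next
  case (Suc J)
  have "f integrable_on {-1..real (Suc J)}"
    by (intro integrable_continuous_real continuous_on_subset[OF assms]) auto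
  then have "integral {-1..real (Suc J)} f
      = integral {-1..real J} f + integral {real J..real (Suc J)} f"
    by (intro Henstock_Kurzweil_Integration.integral_combine[symmetric]) auto
  also have "integral {real J..real (Suc J)} f = integral {0..1} (\<lambda>y. f (y - 1 + real (Suc J)))"
    using integral_shift_real_ivl[of "real J" "real J" "real (Suc J)" f] by simp
  finally show ?case using Suc by simp
qed

lemma integral_support:
  fixes f :: "real \<Rightarrow> 'a::euclidean_space"
  assumes "{c..d} \<subseteq> {c'..d'}" "\<And>x. x \<le> c \<Longrightarrow> f x = 0" "\<And>x. d \<le> x \<Longrightarrow> f x = 0"
  shows "integral {c'..d'} f = integral {c..d} f"
proof -
  have "integral {c'..d'} f = integral {c'..d'} (\<lambda>x. if x \<in> {c..d} then f x else 0)"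
    using assms by (intro integral_cong) auto
  also have "\<dots> = integral {c..d} f"
    using assms(1) by (simp only: integral_restrict_Int Int_absorb2)
  finally show ?thesis .
qed

lemma has_integral_inversion:
  fixes f :: "real \<Rightarrow> 'a::euclidean_space"
  assumes "0 < \<gamma>" "0 < c" "c \<le> d" and cont: "continuous_on {c..d} f"
  shows "((\<lambda>z. (\<gamma> / z\<^sup>2) *\<^sub>R f (\<gamma> / z)) has_integral integral {c..d} f) {\<gamma>/d..\<gamma>/c}"
proof -
  have "((\<lambda>z. (- \<gamma> / z\<^sup>2) *\<^sub>R f (\<gamma> / z)) has_integral
      (integral {\<gamma> / (\<gamma>/d)..\<gamma> / (\<gamma>/c)} f - integral {\<gamma> / (\<gamma>/c)..\<gamma> / (\<gamma>/d)} f)) {\<gamma>/d..\<gamma>/c}"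
  proof (rule has_integral_substitution_general[of "{}" _ _ _ c d])
    show "\<gamma>/d \<le> \<gamma>/c" using assms by (simp add: frac_le)
    show "(\<lambda>z. \<gamma> / z) ` {\<gamma>/d..\<gamma>/c} \<subseteq> {c..d}"
    proof clarify
      fix z assume z: "z \<in> {\<gamma>/d..\<gamma>/c}"
      have "0 < \<gamma>/d" using assms by simp
      then have "0 < z" using z by auto
      then show "\<gamma> / z \<in> {c..d}"
        using z assms by (auto simp: field_simps)
    qed
    have pos: "z > 0" if "z \<in> {\<gamma>/d..\<gamma>/c}" for z
      using that assms by (auto intro: less_le_trans[of 0 "\<gamma>/d"])
    show "continuous_on {\<gamma>/d..\<gamma>/c} (\<lambda>z. \<gamma> / z)"
      using pos by (intro continuous_intros) fastforce
    show "((\<lambda>z. \<gamma> / z) has_real_derivative - \<gamma> / z\<^sup>2) (at z within {\<gamma>/d..\<gamma>/c})"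
      if "z \<in> {\<gamma>/d..\<gamma>/c} - {}" for z
      using pos[of z] that by (auto intro!: derivative_eq_intros simp: power2_eq_square)
  qed (use cont in auto)
  moreover have "\<gamma> / (\<gamma>/d) = d" "\<gamma> / (\<gamma>/c) = c" using assms by auto
  \<comment> \<open>The substitution is decreasing: of the two oppositely oriented integrals in the
    substitution rule, this one is degenerate and the other carries the minus sign.\<close>
  moreover have "integral {d..c} f = 0" 
    using assms by (cases "c = d") auto
  ultimately have "((\<lambda>z. (- \<gamma> / z\<^sup>2) *\<^sub>R f (\<gamma> / z)) has_integral (- integral {c..d} f)) {\<gamma>/d..\<gamma>/c}"
    by simp
  from has_integral_neg[OF this] show ?thesis by simp
qed

lemma integral_0_2:
  fixes f :: "real \<Rightarrow> real"
  assumes "continuous_on UNIV f"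
  shows "integral {0..2} f = integral {0..1} (\<lambda>x. f x + f (x + 1))"
proof -
  have i: "f integrable_on {u..v}" for u v
    by (intro integrable_continuous_real continuous_on_subset[OF assms]) auto
  have "integral {0..2} f = integral {0..1} f + integral {1..2} f"
    by (intro Henstock_Kurzweil_Integration.integral_combine[symmetric] i) auto
  also have "integral {1..2} f = integral {0..1} (\<lambda>x. f (x + 1))"
    using integral_shift_real_ivl[of 1 1 2 f] by simp
  also have "integral {0..1} f + \<dots> = integral {0..1} (\<lambda>x. f x + f (x + 1))"
    by (intro integral_add[symmetric] i integrable_continuous_real
        continuous_on_compose2[OF assms] continuous_intros) auto
  finally show ?thesis .
qed

section \<open>Continuously differentiable functions\<close>

definition C1 :: "(real \<Rightarrow> real) \<Rightarrow> bool"
  where "C1 f \<longleftrightarrow> (\<forall>x. (f has_real_derivative deriv f x) (at x)) \<and> continuous_on UNIV (deriv f)"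

lemma C1I:
  assumes "\<And>x. (f has_real_derivative f' x) (at x)" "continuous_on UNIV f'"
  shows "C1 f" "deriv f = f'"
proof -
  show "deriv f = f'" using assms(1) by (auto intro!: ext DERIV_imp_deriv)
  then show "C1 f" using assms by (simp add: C1_def)
qed

lemma C1_DERIV: "C1 f \<Longrightarrow> (f has_real_derivative deriv f x) (at x)"
  by (simp add: C1_def)

lemma C1_continuous_deriv: "C1 f \<Longrightarrow> continuous_on A (deriv f)"
  by (auto simp: C1_def intro: continuous_on_subset)

lemma C1_continuous: "C1 f \<Longrightarrow> continuous_on A f"
  by (meson C1_DERIV DERIV_isCont continuous_at_imp_continuous_on)

lemma C1_chain:
  assumes "C1 f" "(g has_real_derivative g') (at x within S)"
  shows "((\<lambda>x. f (g x)) has_real_derivative deriv f (g x) * g') (at x within S)"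
  using DERIV_chain2[OF C1_DERIV[OF assms(1)] assms(2)] .

lemma C1_add:
  assumes "C1 f" "C1 g"
  shows "C1 (\<lambda>x. f x + g x)" "deriv (\<lambda>x. f x + g x) = (\<lambda>x. deriv f x + deriv g x)"
proof -
  have 1: "((\<lambda>x. f x + g x) has_real_derivative (deriv f x + deriv g x)) (at x)" for x
    using assms by (intro DERIV_add C1_DERIV)
  have 2: "continuous_on UNIV (\<lambda>x. deriv f x + deriv g x)"
    using assms by (intro continuous_intros C1_continuous_deriv)
  show "C1 (\<lambda>x. f x + g x)" "deriv (\<lambda>x. f x + g x) = (\<lambda>x. deriv f x + deriv g x)"
    by (rule C1I[OF 1 2])+
qed

lemma C1_const: "C1 (\<lambda>x. c)" "deriv (\<lambda>x. c) = (\<lambda>x. 0)"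
  by (rule C1I[of _ "\<lambda>x. 0"]; auto)+

lemma C1_sum:
  assumes "finite I" "\<And>i. i \<in> I \<Longrightarrow> C1 (f i)"
  shows "C1 (\<lambda>x. \<Sum>i\<in>I. f i x) \<and> deriv (\<lambda>x. \<Sum>i\<in>I. f i x) = (\<lambda>x. \<Sum>i\<in>I. deriv (f i) x)"
  using assms by (induction I rule: finite_induct) (simp_all add: C1_const C1_add)

lemma C1_mult:
  assumes "C1 f" "C1 g"
  shows "C1 (\<lambda>x. f x * g x)" "deriv (\<lambda>x. f x * g x) = (\<lambda>x. deriv f x * g x + deriv g x * f x)"
proof -
  have 1: "((\<lambda>x. f x * g x) has_real_derivative (deriv f x * g x + deriv g x * f x)) (at x)" for x
    using assms by (intro DERIV_mult C1_DERIV)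
  have 2: "continuous_on UNIV (\<lambda>x. deriv f x * g x + deriv g x * f x)"
    using assms by (intro continuous_intros C1_continuous_deriv C1_continuous)
  show "C1 (\<lambda>x. f x * g x)" "deriv (\<lambda>x. f x * g x) = (\<lambda>x. deriv f x * g x + deriv g x * f x)"
    by (rule C1I[OF 1 2])+
qed

lemma C1_affine:
  assumes "C1 f"
  shows "C1 (\<lambda>x. f (c * x + d))" "deriv (\<lambda>x. f (c * x + d)) = (\<lambda>x. c * deriv f (c * x + d))"
proof -
  have 1: "((\<lambda>x. f (c * x + d)) has_real_derivative (c * deriv f (c * x + d))) (at x)" for x
  proof -
    have "((\<lambda>x. c * x + d) has_real_derivative c) (at x)"
      by (auto intro!: derivative_eq_intros)
    from C1_chain[OF assms this] show ?thesis by (simp add: mult.commute)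
  qed
  have 2: "continuous_on UNIV (\<lambda>x. c * deriv f (c * x + d))"
    by (intro continuous_intros continuous_on_compose2[OF C1_continuous_deriv[OF assms, of UNIV]]) auto
  show "C1 (\<lambda>x. f (c * x + d))" "deriv (\<lambda>x. f (c * x + d)) = (\<lambda>x. c * deriv f (c * x + d))"
    by (rule C1I[OF 1 2])+
qed

lemma C1_diff:
  assumes "C1 f" "C1 g"
  shows "C1 (\<lambda>x. f x - g x)" "deriv (\<lambda>x. f x - g x) = (\<lambda>x. deriv f x - deriv g x)"
proof -
  have 1: "((\<lambda>x. f x - g x) has_real_derivative (deriv f x - deriv g x)) (at x)" for x
    using assms by (intro DERIV_diff C1_DERIV)
  have 2: "continuous_on UNIV (\<lambda>x. deriv f x - deriv g x)"
    using assms by (intro continuous_intros C1_continuous_deriv)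
  show "C1 (\<lambda>x. f x - g x)" "deriv (\<lambda>x. f x - g x) = (\<lambda>x. deriv f x - deriv g x)"
    by (rule C1I[OF 1 2])+
qed

text \<open>Continuity of the derivative extends its vanishing from an open set to the boundary,
  which covers the endpoints of supports and of the unit interval.\<close>

lemma C1_deriv_zero:
  assumes "C1 f" "open U" "x \<in> closure U" "\<And>y. y \<in> U \<Longrightarrow> f y = 0"
  shows "deriv f x = 0"
proof -
  have "deriv f y = 0" if "y \<in> U" for y
  proof -
    have "(f has_real_derivative 0) (at y)"
      by (rule has_field_derivative_transform_within_open[OF DERIV_const[of 0] assms(2) that])
        (simp add: assms(4))
    then show ?thesis by (rule DERIV_imp_deriv)
  qed
  moreover have "closed {x. deriv f x = 0}"
    by (intro closed_Collect_eq continuous_on_const C1_continuous_deriv[OF assms(1)])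
  ultimately have "closure U \<subseteq> {x. deriv f x = 0}"
    by (intro closure_minimal subsetI CollectI)
  then show ?thesis using assms(3) by auto
qed

section \<open>Quadratic splines: ramps and bumps\<close>

lemma C1_pos_sq: "C1 (\<lambda>t. (max 0 t)\<^sup>2)" "deriv (\<lambda>t::real. (max 0 t)\<^sup>2) = (\<lambda>t. 2 * max 0 t)"
proof -
  have 1: "((\<lambda>t::real. (max 0 t)\<^sup>2) has_real_derivative 2 * max 0 t) (at t)" for t
  proof -
    consider "t > 0" | "t < 0" | "t = 0" by linarith
    then show ?thesis
    proof cases
      case 1
      have "((\<lambda>t::real. t\<^sup>2) has_real_derivative 2 * max 0 t) (at t)"
        using 1 by (auto intro!: derivative_eq_intros)
      then show ?thesis
        by (rule has_field_derivative_transform_within_open[where S = "{0<..}"]) (use 1 in auto)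
    next
      case 2
      have "((\<lambda>t::real. 0) has_real_derivative 2 * max 0 t) (at t)"
        using 2 by auto
      then show ?thesis
        by (rule has_field_derivative_transform_within_open[where S = "{..<0}"]) (use 2 in auto)
    next
      case 3
      have "((\<lambda>h::real. max 0 h ^ 2 / h) \<longlongrightarrow> 0) (at 0)"
      proof (rule Lim_null_comparison)
        show "((\<lambda>h::real. \<bar>h\<bar>) \<longlongrightarrow> 0) (at 0)" by (rule tendsto_eq_intros | simp)+
        show "\<forall>\<^sub>F x::real in at 0. norm ((max 0 x)\<^sup>2 / x) \<le> \<bar>x\<bar>"
          by (auto simp: eventually_at_filter max_def power2_eq_square)
      qed
      then show ?thesis using 3 by (simp add: DERIV_def)
    qed
  qed
  have 2: "continuous_on UNIV (\<lambda>t::real. 2 * max 0 t)" by (intro continuous_intros)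
  show "C1 (\<lambda>t. (max 0 t)\<^sup>2)" "deriv (\<lambda>t::real. (max 0 t)\<^sup>2) = (\<lambda>t. 2 * max 0 t)"
    by (rule C1I[OF 1 2])+
qed

text \<open>A C1 spline rising from 0 to 1 on [0, 1]; its derivative is the tent with peak 2 at 1/2.
  One continuous derivative suffices throughout.\<close>

definition ramp :: "real \<Rightarrow> real"
  where "ramp t = 2 * (max 0 t)\<^sup>2 - 4 * (max 0 (t - 1/2))\<^sup>2 + 2 * (max 0 (t - 1))\<^sup>2"

lemma C1_ramp: "C1 ramp" 
  and deriv_ramp: "deriv ramp = (\<lambda>t. 4 * max 0 t - 8 * max 0 (t - 1/2) + 4 * max 0 (t - 1))"
proof -
  have s: "C1 (\<lambda>t. k * (max 0 (t - c))\<^sup>2) \<and>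
      deriv (\<lambda>t. k * (max 0 (t - c))\<^sup>2) = (\<lambda>t. k * (2 * max 0 (t - c)))" for k c :: real
    using C1_affine[OF C1_pos_sq(1), of 1 "- c"] C1_mult[OF C1_const(1)[of k], of "\<lambda>t. (max 0 (t - c))\<^sup>2"]
    by (simp add: C1_const C1_pos_sq mult.commute)
  have eq: "ramp = (\<lambda>t. (2 * (max 0 (t - 0))\<^sup>2 - 4 * (max 0 (t - 1/2))\<^sup>2) + 2 * (max 0 (t - 1))\<^sup>2)"
    by (auto simp: ramp_def)
  show "C1 ramp" unfolding eq by (intro C1_add(1) C1_diff(1) conjunct1[OF s])
  show "deriv ramp = (\<lambda>t. 4 * max 0 t - 8 * max 0 (t - 1/2) + 4 * max 0 (t - 1))"
    unfolding eq
    by (simp only: C1_add(2)[OF C1_diff(1)[OF conjunct1[OF s] conjunct1[OF s]] conjunct1[OF s]]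
        C1_diff(2)[OF conjunct1[OF s] conjunct1[OF s]] conjunct2[OF s]) (auto simp: fun_eq_iff)
qed

lemma ramp_0: "t \<le> 0 \<Longrightarrow> ramp t = 0"
  by (simp add: ramp_def)

lemma ramp_1: "1 \<le> t \<Longrightarrow> ramp t = 1"
  by (simp add: ramp_def power2_eq_square algebra_simps)

lemma deriv_ramp_nonneg: "0 \<le> deriv ramp t"
  by (auto simp: deriv_ramp max_def)

lemma mono_ramp: "x \<le> y \<Longrightarrow> ramp x \<le> ramp y"
  using C1_DERIV[OF C1_ramp] deriv_ramp_nonneg by (intro DERIV_nonneg_imp_nondecreasing[of x y ramp]) auto

lemma ramp_range: "0 \<le> ramp t" "ramp t \<le> 1"
  using mono_ramp[of "min 0 t" t] mono_ramp[of t "max 1 t"] by (simp_all add: ramp_0 ramp_1)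

definition bump :: "real \<Rightarrow> real \<Rightarrow> real \<Rightarrow> real"
  where "bump u v x = (max 0 (x - u))\<^sup>2 * (max 0 (v - x))\<^sup>2"

lemma C1_bump: "C1 (bump u v)"
proof -
  have "C1 (\<lambda>x. (max 0 (1 * x + (- u)))\<^sup>2 * (max 0 ((- 1) * x + v))\<^sup>2)"
    by (intro C1_mult(1) C1_affine(1)[OF C1_pos_sq(1)])
  then show ?thesis by (simp add: bump_def[abs_def])
qed

lemma bump_0: "x \<le> u \<or> v \<le> x \<Longrightarrow> bump u v x = 0"
  by (auto simp: bump_def)

lemma bump_pos: "u < x \<Longrightarrow> x < v \<Longrightarrow> 0 < bump u v x"
  by (simp add: bump_def)

lemma integral_bump_sq:
  assumes "u < v"
  shows "integral {u..v} (\<lambda>x. (bump u v x)\<^sup>2) \<noteq> 0"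
proof
  assume "integral {u..v} (\<lambda>x. (bump u v x)\<^sup>2) = 0"
  moreover have "continuous_on {u..v} (\<lambda>x. (bump u v x)\<^sup>2)"
    by (intro continuous_intros C1_continuous C1_bump)
  ultimately have "\<forall>x\<in>{u..v}. (bump u v x)\<^sup>2 = 0"
    using assms by (simp add: integral_eq_0_iff)
  then have "bump u v ((u + v) / 2) = 0" using assms by auto
  moreover have "0 < bump u v ((u + v) / 2)" using assms by (intro bump_pos) auto
  ultimately show False by simp
qed

section \<open>Variation and interpolation of periodic functions\<close>

text \<open>Functions on the circle are represented by functions on the line that satisfy
  \<open>p (x + 1) = p x\<close> only for \<open>x\<close> in \<open>[0, 1]\<close>: the transfer operator below evaluates its
  argument on \<open>[0, 2]\<close> only, and its values, being finite sums, are periodic only there.\<close>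

definition per :: "(real \<Rightarrow> real) \<Rightarrow> bool"
  where "per p \<longleftrightarrow> (\<forall>x\<in>{0..1}. p (x + 1) = p x)"

definition Var :: "(real \<Rightarrow> real) \<Rightarrow> real"
  where "Var p = integral {0..1} (\<lambda>x. \<bar>deriv p x\<bar>)"

definition L1 :: "(real \<Rightarrow> real) \<Rightarrow> real"
  where "L1 p = integral {0..1} (\<lambda>x. \<bar>p x\<bar>)"

text \<open>The difference of \<open>p (x + 1)\<close> and \<open>p x\<close> vanishes on the open
  unit interval, hence so does its derivative, up to the endpoints by continuity.\<close>

lemma per_deriv:
  assumes "per p" "C1 p" "x \<in> {0..1}"
  shows "deriv p (x + 1) = deriv p x"
proof -
  have 1: "C1 (\<lambda>x. p (1 * x + 1) - p x)" "deriv (\<lambda>x. p (1 * x + 1) - p x) = (\<lambda>x. deriv p (x+1) - deriv p x)"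
    using C1_diff[OF C1_affine(1)[OF assms(2)] assms(2), of 1 1] C1_affine(2)[OF assms(2), of 1 1] by auto
  have "deriv (\<lambda>x. p (1 * x + 1) - p x) x = 0"
    by (rule C1_deriv_zero[OF 1(1), of "{0<..<1}"]) (use assms in \<open>auto simp: per_def\<close>)
  then show ?thesis unfolding 1(2) by simp
qed

lemma integral_deriv:
  assumes "C1 p" "u \<le> v"
  shows "integral {u..v} (deriv p) = p v - p u"
  using assms by (intro integral_unique fundamental_theorem_of_calculus)
    (auto simp: has_real_derivative_iff_has_vector_derivative[symmetric]
      intro: C1_DERIV has_field_derivative_at_within)

lemma C1_increment:
  assumes "C1 p" "u \<le> v"
  shows "\<bar>p v - p u\<bar> \<le> integral {u..v} (\<lambda>x. \<bar>deriv p x\<bar>)"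
  unfolding integral_deriv[OF assms, symmetric]
  unfolding real_norm_def[symmetric]
  by (intro integral_norm_bound_integral integrable_continuous_real continuous_intros
      C1_continuous_deriv assms(1)) simp

text \<open>For every t in [0, 1] the value at x differs from the value at t by at most
  \<open>Var p\<close>; averaging over t gives the bound. It turns estimates of \<open>Var\<close>
  and \<open>L1\<close> into uniform convergence.\<close>

lemma C1_sup_bound:
  assumes "C1 p" "x \<in> {0..1}"
  shows "\<bar>p x\<bar> \<le> Var p + L1 p"
proof -
  have int: "(\<lambda>x. \<bar>p x\<bar>) integrable_on {0..1}" "\<And>u v. (\<lambda>x. \<bar>deriv p x\<bar>) integrable_on {u..v}"
    by (intro integrable_continuous_real continuous_intros C1_continuous_deriv[OF assms(1)] C1_continuous[OF assms(1)])+
  have "\<bar>p x\<bar> \<le> Var p + \<bar>p t\<bar>" if "t \<in> {0..1}" for t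
  proof -
    have "\<bar>p (max x t) - p (min x t)\<bar> \<le> integral {min x t..max x t} (\<lambda>x. \<bar>deriv p x\<bar>)"
      by (rule C1_increment[OF assms(1)]) auto
    also have "\<dots> \<le> Var p"
      unfolding Var_def using assms that by (intro integral_subset_le int) auto
    finally show ?thesis by (auto simp: max_def min_def split: if_splits)
  qed
  then have "integral {0..1} (\<lambda>t::real. \<bar>p x\<bar>) \<le> integral {0..1} (\<lambda>t. Var p + \<bar>p t\<bar>)"
    by (intro Henstock_Kurzweil_Integration.integral_le integrable_add int integrable_const_ivl) auto
  also have "\<dots> = Var p + L1 p"
    unfolding L1_def by (subst integral_add) (auto intro!: int)
  finally show ?thesis by simp
qed

lemma Var_diff:
  assumes "C1 p" "C1 q"
  shows "Var (\<lambda>x. p x - q x) \<le> Var p + Var q"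
proof -
  have c: "continuous_on A (deriv p)" "continuous_on A (deriv q)" for A
    by (intro C1_continuous_deriv assms)+
  have "Var (\<lambda>x. p x - q x) \<le> integral {0..1} (\<lambda>x. \<bar>deriv p x\<bar> + \<bar>deriv q x\<bar>)"
    unfolding Var_def C1_diff(2)[OF assms]
    by (intro Henstock_Kurzweil_Integration.integral_le integrable_continuous_real
        continuous_intros c) (rule abs_triangle_ineq4)
  also have "\<dots> = Var p + Var q"
    unfolding Var_def by (intro integral_add integrable_continuous_real continuous_intros c)
  finally show ?thesis .
qed

lemma Var_nonneg: "0 \<le> Var p" and L1_nonneg: "0 \<le> L1 p"
proof -
  \<comment> \<open>No regularity is assumed: a non-integrable function has integral 0 by
    convention.\<close>
  have "0 \<le> integral {0..1} (\<lambda>x. \<bar>f x\<bar>)" for f :: "real \<Rightarrow> real"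
    by (cases "(\<lambda>x. \<bar>f x\<bar>) integrable_on {0..1}")
      (auto simp: not_integrable_integral intro: Henstock_Kurzweil_Integration.integral_nonneg)
  then show "0 \<le> Var p" "0 \<le> L1 p" unfolding Var_def L1_def by blast+
qed

lemma per_diff: "per p \<Longrightarrow> per q \<Longrightarrow> per (\<lambda>x. p x - q x)"
  by (simp add: per_def)

text \<open>Interpolation at the nodes l / M by ramps, which keep it C1, written as a running sum of
  increments. The nodes cover [0, 2], where \<open>Q\<close> evaluates its argument. Only finitely
  many values of \<open>p\<close> enter, whence the finite rank.\<close>

definition interp :: "nat \<Rightarrow> (real \<Rightarrow> real) \<Rightarrow> real \<Rightarrow> real"
  where "interp M p x = p 0 + (\<Sum>l<2*M. (p (real (Suc l) / real M) - p (real l / real M))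
    * ramp (real M * x - real l))"

lemma interp_regular:
  shows "C1 (interp M p)"
    "deriv (interp M p) = (\<lambda>x. \<Sum>l<2*M. (p (real (Suc l) / real M) - p (real l / real M))
      * (real M * deriv ramp (real M * x - real l)))"
proof -
  have r: "C1 (\<lambda>x. ramp (real M * x - real l)) \<and>
      deriv (\<lambda>x. ramp (real M * x - real l)) = (\<lambda>x. real M * deriv ramp (real M * x - real l))" for l
    using C1_affine[OF C1_ramp, of "real M" "- real l"] by simp
  have rc: "C1 (\<lambda>x. c * ramp (real M * x - real l)) \<and>
      deriv (\<lambda>x. c * ramp (real M * x - real l))
        = (\<lambda>x. c * (real M * deriv ramp (real M * x - real l)))" for c l
    using C1_mult[OF C1_const(1) conjunct1[OF r], of c l] conjunct2[OF r, of l]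
    by (simp add: C1_const mult.commute)
  have s: "C1 (\<lambda>x. \<Sum>l<2*M. c l * ramp (real M * x - real l)) \<and>
      deriv (\<lambda>x. \<Sum>l<2*M. c l * ramp (real M * x - real l))
        = (\<lambda>x. \<Sum>l<2*M. deriv (\<lambda>x. c l * ramp (real M * x - real l)) x)" for c
    using rc by (intro C1_sum) auto
  show "C1 (interp M p)"
    "deriv (interp M p) = (\<lambda>x. \<Sum>l<2*M. (p (real (Suc l) / real M) - p (real l / real M))
      * (real M * deriv ramp (real M * x - real l)))"
    unfolding interp_def[abs_def]
    using C1_add[OF C1_const(1)[of "p 0"] conjunct1[OF s]] conjunct2[OF rc] conjunct2[OF s]
    by (simp_all add: C1_const)
qed

lemma sum_lessThan_split: "(\<Sum>l<m + n. f l) = (\<Sum>l<m. f l) + (\<Sum>l<n. f (m + l :: nat))"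
  for f :: "nat \<Rightarrow> 'a::comm_monoid_add"
  by (induction n) (simp_all add: add.assoc)

text \<open>The increments repeat after M nodes and sum to 0 over one period. At x + 1 the first M
  ramps are saturated and the others reproduce the first M ramps at x, where those others have not
  yet started.\<close>

lemma per_interp:
  assumes "per p" "0 < M"
  shows "per (interp M p)"
  unfolding per_def
proof
  fix x :: real assume x: "x \<in> {0..1}"
  define \<Delta> where "\<Delta> l = p (real (Suc l) / real M) - p (real l / real M)" for l
  have p1: "p (1 + real l / real M) = p (real l / real M)" if "l \<le> M" for l
    using assms that by (auto simp: per_def add.commute)
  have shift: "\<Delta> (M + l) = \<Delta> l" if "l < M" for l
    using p1[of l] p1[of "Suc l"] that assms(2) by (simp add: \<Delta>_def add_divide_distrib add.left_commute)
  have tele: "(\<Sum>l<M. \<Delta> l) = 0"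
    using sum_lessThan_telescope[of "\<lambda>l. p (real l / real M)" M] p1[of 0] assms(2)
    by (simp add: \<Delta>_def)
  have Mx: "0 \<le> real M * x" "real M * x \<le> real M"
    using x by (auto simp: mult_left_le)
  have E: "interp M p z = p 0 + ((\<Sum>l<M. \<Delta> l * ramp (real M * z - real l))
      + (\<Sum>l<M. \<Delta> (M + l) * ramp (real M * z - real (M + l))))" for z
    using sum_lessThan_split[of "\<lambda>l. \<Delta> l * ramp (real M * z - real l)" M M]
    by (simp add: interp_def \<Delta>_def mult_2)
  have "(\<Sum>l<M. \<Delta> l * ramp (real M * (x + 1) - real l)) = (\<Sum>l<M. \<Delta> l)"
  proof (rule sum.cong)
    fix l assume "l \<in> {..<M}"
    then have "ramp (real M * (x + 1) - real l) = 1"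
      using Mx by (intro ramp_1) (simp add: distrib_left)
    then show "\<Delta> l * ramp (real M * (x + 1) - real l) = \<Delta> l" by simp
  qed simp
  moreover have "(\<Sum>l<M. \<Delta> (M + l) * ramp (real M * (x + 1) - real (M + l)))
      = (\<Sum>l<M. \<Delta> l * ramp (real M * x - real l))"
    by (intro sum.cong) (auto simp: shift distrib_left)
  moreover have "(\<Sum>l<M. \<Delta> (M + l) * ramp (real M * x - real (M + l))) = 0"
    using Mx by (intro sum.neutral) (auto simp: ramp_0)
  ultimately show "interp M p (x + 1) = interp M p x"
    unfolding E by (simp add: tele)
qed

lemma integral_cells:
  fixes f :: "real \<Rightarrow> real"
  assumes "continuous_on UNIV f" "0 < M"
  shows "integral {0..1} f = (\<Sum>l<M. integral {real l / real M..real (Suc l) / real M} f)"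
proof -
  have "integral {0..real n / real M} f
      = (\<Sum>l<n. integral {real l / real M..real (Suc l) / real M} f)" for n
  proof (induction n)
    case (Suc n)
    have "integral {0..real (Suc n) / real M} f = integral {0..real n / real M} f
        + integral {real n / real M..real (Suc n) / real M} f"
      by (intro Henstock_Kurzweil_Integration.integral_combine[symmetric] integrable_continuous_real
          continuous_on_subset[OF assms(1)]) (auto simp: divide_right_mono)
    then show ?case using Suc by simp
  qed simp
  from this[of M] show ?thesis using assms(2) by simp
qed

text \<open>On the unit interval each of the first M ramps rises by 1 and the others are 0, so the
  variation is at most the sum of the absolute increments, each bounded by the variation of
  \<open>p\<close> over its cell.\<close>

lemma Var_interp:
  assumes "C1 p" "0 < M"
  shows "Var (interp M p) \<le> Var p"
proof -
  define \<Delta> where "\<Delta> l = p (real (Suc l) / real M) - p (real l / real M)" for l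
  define D where "D l x = real M * deriv ramp (real M * x - real l)" for l x
  have D: "deriv (interp M p) = (\<lambda>x. \<Sum>l<2*M. \<Delta> l * D l x)"
    by (simp add: interp_regular(2) \<Delta>_def D_def)
  have D0: "0 \<le> D l x" for l x by (simp add: D_def deriv_ramp_nonneg)
  have aff: "C1 (\<lambda>x. ramp (real M * x - real l))" "deriv (\<lambda>x. ramp (real M * x - real l)) = D l" for l
    using C1_affine[OF C1_ramp, of "real M" "- real l"] by (auto simp: D_def)
  have cD: "continuous_on A (D l)" for l A
    using C1_continuous_deriv[OF aff(1)] by (simp add: aff(2))
  have intD: "integral {0..1} (D l) = (if l < M then 1 else 0)" for l
    using integral_deriv[OF aff(1), of 0 1 l] by (auto simp: aff(2) ramp_0 ramp_1)
  have "Var (interp M p) \<le> integral {0..1} (\<lambda>x. \<Sum>l<2*M. \<bar>\<Delta> l\<bar> * D l x)"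
    unfolding Var_def
  proof (rule Henstock_Kurzweil_Integration.integral_le)
    show "(\<lambda>x. \<bar>deriv (interp M p) x\<bar>) integrable_on {0..1}"
      by (intro integrable_continuous_real continuous_intros C1_continuous_deriv interp_regular)
    show "(\<lambda>x. \<Sum>l<2*M. \<bar>\<Delta> l\<bar> * D l x) integrable_on {0..1}"
      by (intro integrable_continuous_real continuous_intros cD)
    show "\<bar>deriv (interp M p) x\<bar> \<le> (\<Sum>l<2*M. \<bar>\<Delta> l\<bar> * D l x)" for x
      unfolding D using D0 by (intro order.trans[OF sum_abs]) (simp add: abs_mult)
  qed
  also have "\<dots> = (\<Sum>l<2*M. integral {0..1} (\<lambda>x. \<bar>\<Delta> l\<bar> * D l x))"
    by (intro integral_sum integrable_continuous_real continuous_intros cD) auto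
  also have "\<dots> = (\<Sum>l<2*M. \<bar>\<Delta> l\<bar> * (if l < M then 1 else 0))"
    by (simp add: intD)
  also have "\<dots> = (\<Sum>l<M. \<bar>\<Delta> l\<bar>)"
    by (rule sum.mono_neutral_cong_right) auto
  also have "\<dots> \<le> (\<Sum>l<M. integral {real l / real M..real (Suc l) / real M} (\<lambda>x. \<bar>deriv p x\<bar>))"
    unfolding \<Delta>_def by (intro sum_mono C1_increment assms(1)) (auto simp: divide_right_mono)
  also have "\<dots> = Var p"
    unfolding Var_def
    by (intro integral_cells[symmetric] continuous_intros C1_continuous_deriv assms)
  finally show ?thesis .
qed

text \<open>Within a cell all earlier ramps are 1 and all later ones are 0, so the running sum
  telescopes.\<close>

lemma interp_cell:
  assumes "0 < M" "l < M" "x \<in> {real l / real M..real (Suc l) / real M}"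
  shows "interp M p x = p (real l / real M)
    + (p (real (Suc l) / real M) - p (real l / real M)) * ramp (real M * x - real l)"
proof -
  define \<Delta> where "\<Delta> l = p (real (Suc l) / real M) - p (real l / real M)" for l
  have Mx: "real l \<le> real M * x" "real M * x \<le> real (Suc l)"
    using assms by (auto simp: field_simps)
  have "(\<Sum>i<2*M. \<Delta> i * ramp (real M * x - real i)) = (\<Sum>i<Suc l. \<Delta> i * ramp (real M * x - real i))"
  proof (rule sum.mono_neutral_right)
    show "\<forall>i\<in>{..<2*M} - {..<Suc l}. \<Delta> i * ramp (real M * x - real i) = 0"
      using Mx by (auto intro!: ramp_0)
  qed (use assms(2) in auto)
  also have "\<dots> = (\<Sum>i<l. \<Delta> i) + \<Delta> l * ramp (real M * x - real l)"
    using Mx by (simp add: ramp_1)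
  also have "(\<Sum>i<l. \<Delta> i) = p (real l / real M) - p 0"
    using sum_lessThan_telescope[of "\<lambda>l. p (real l / real M)" l] by (simp add: \<Delta>_def)
  finally show ?thesis by (simp add: interp_def \<Delta>_def)
qed

text \<open>On a cell both \<open>p\<close> and its interpolant stay within the variation
  \<open>v l\<close> over the cell from the value at the left node; the cell has length 1 /
  M.\<close>

lemma L1_interp:
  assumes "C1 p" "0 < M"
  shows "L1 (\<lambda>x. p x - interp M p x) \<le> 2 / real M * Var p"
proof -
  define v where "v l = integral {real l / real M..real (Suc l) / real M} (\<lambda>x. \<bar>deriv p x\<bar>)" for l
  have cont: "continuous_on A (\<lambda>x. \<bar>p x - interp M p x\<bar>)" for A
    by (intro continuous_intros C1_continuous assms interp_regular)
  have bound: "\<bar>p x - interp M p x\<bar> \<le> 2 * v l"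
    if "l < M" and x: "x \<in> {real l / real M..real (Suc l) / real M}" for l x
  proof -
    have int: "(\<lambda>x. \<bar>deriv p x\<bar>) integrable_on {c..d}" for c d
      by (intro integrable_continuous_real continuous_intros C1_continuous_deriv assms(1))
    have "\<bar>p x - p (real l / real M)\<bar> \<le> integral {real l / real M..x} (\<lambda>x. \<bar>deriv p x\<bar>)"
      using x by (intro C1_increment assms(1)) auto
    also have "\<dots> \<le> v l"
      unfolding v_def using x by (intro integral_subset_le int) auto
    finally have 1: "\<bar>p x - p (real l / real M)\<bar> \<le> v l" .
    have "\<bar>p (real (Suc l) / real M) - p (real l / real M)\<bar> \<le> v l"
      unfolding v_def by (intro C1_increment assms(1)) (auto simp: divide_right_mono)
    then have "\<bar>(p (real (Suc l) / real M) - p (real l / real M)) * ramp (real M * x - real l)\<bar> \<le> v l * 1"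
      unfolding abs_mult using ramp_range by (intro mult_mono) auto
    with 1 show ?thesis unfolding interp_cell[OF assms(2) that] by linarith
  qed
  have "L1 (\<lambda>x. p x - interp M p x)
      = (\<Sum>l<M. integral {real l / real M..real (Suc l) / real M} (\<lambda>x. \<bar>p x - interp M p x\<bar>))"
    unfolding L1_def by (rule integral_cells[OF cont assms(2)])
  also have "\<dots> \<le> (\<Sum>l<M. 2 / real M * v l)"
  proof (rule sum_mono)
    fix l assume "l \<in> {..<M}"
    then have "integral {real l / real M..real (Suc l) / real M} (\<lambda>x. \<bar>p x - interp M p x\<bar>)
        \<le> integral {real l / real M..real (Suc l) / real M} (\<lambda>x. 2 * v l)"
      by (intro Henstock_Kurzweil_Integration.integral_le integrable_continuous_real cont bound
          continuous_intros) auto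
    also have "\<dots> = 2 / real M * v l"
      using assms(2) by (simp add: divide_right_mono flip: diff_divide_distrib)
    finally show "integral {real l / real M..real (Suc l) / real M} (\<lambda>x. \<bar>p x - interp M p x\<bar>)
        \<le> 2 / real M * v l" .
  qed
  also have "\<dots> = 2 / real M * Var p"
    unfolding Var_def v_def
    by (subst integral_cells[of "\<lambda>x. \<bar>deriv p x\<bar>" M])
      (auto simp: sum_distrib_left assms(2) intro!: continuous_intros C1_continuous_deriv assms(1))
  finally show ?thesis .
qed

section \<open>The transfer operator\<close>

text \<open>The bound \<open>b\<^sup>2 < \<gamma>\<close> serves twice: the quotient is the
  contraction factor for the variation, and it leaves room for the free bump between sqrt \<gamma>
  and \<gamma> / b. The number \<open>J\<close> reaches \<gamma> / a for a = (b - 1) / 2, beyond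
  which the image under \<open>sharp\<close> of a function vanishing on x \<le> a is 0.\<close>

locale gauss_type_map =
  fixes \<gamma> b :: real and J :: nat
  assumes b_bounds: "1 < b" "b < 2" and b_sq: "b\<^sup>2 < \<gamma>" and J_ge: "\<gamma> / ((b - 1) / 2) \<le> real J"
begin

text \<open>With this choice b = 1 + 2 a: \<open>cut\<close> rises on [a, 2 a] and falls one period
  later, on [1 + a, b].\<close>

definition a :: real where "a = (b - 1) / 2"

text \<open>The translates of \<open>cut\<close> form a partition of unity on the half-line. Its support
  \<open>[a, b]\<close> overshoots the unit interval, so that \<open>Q\<close> preserves regularity and no branch of
  \<open>x \<mapsto> \<gamma> / x\<close> modulo 1 has to be truncated, and it avoids 0, so that only finitely many
  branches occur.\<close>

definition cut :: "real \<Rightarrow> real"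
  where "cut x = ramp ((x - a) / a) - ramp ((x - 1 - a) / a)"

text \<open>The action of the substitution \<open>x \<mapsto> \<gamma> / x\<close> on densities; its value at 0
  is 0, by division by zero.\<close>

definition sharp :: "(real \<Rightarrow> real) \<Rightarrow> real \<Rightarrow> real"
  where "sharp f x = \<gamma> / x\<^sup>2 * f (\<gamma> / x)"

text \<open>The sum starts at \<open>y - 1\<close> so that it is the full periodization, for \<open>f\<close> supported in
  \<open>[0, J]\<close>, on all of \<open>[0, 2]\<close>.\<close>

definition peri :: "(real \<Rightarrow> real) \<Rightarrow> real \<Rightarrow> real"
  where "peri f y = (\<Sum>j\<le>J. f (y - 1 + real j))"

text \<open>Pushes the density \<open>cut * p\<close> forward under x -> \<gamma> / x and wraps it
  onto the circle. Formally, the indicator of the unit interval in place of \<open>cut\<close>, with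
  infinitely many branches, would give the Perron--Frobenius operator of the Gauss-type map.\<close>

definition Q :: "(real \<Rightarrow> real) \<Rightarrow> real \<Rightarrow> real"
  where "Q p = peri (sharp (\<lambda>x. cut x * p x))"

section \<open>Parameters and cut-off\<close>

lemma a_pos: "0 < a" and a_lt: "a < 1/2" and b_eq: "b = 1 + 2 * a"
  using b_bounds by (auto simp: a_def field_simps)

lemma \<gamma>_gt_1: "1 < \<gamma>"
proof -
  have "1 < b\<^sup>2" using b_bounds by (simp add: one_less_power)
  then show ?thesis using b_sq by linarith
qed

lemma J_ge_a: "\<gamma> / a \<le> real J"
  using J_ge by (simp add: a_def)

lemma J_ge_2: "2 \<le> J"
proof -
  have "2 \<le> \<gamma> / a" using a_pos a_lt \<gamma>_gt_1 by (simp add: field_simps)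
  then have "2 \<le> real J" using J_ge_a by linarith
  then show ?thesis by simp
qed

lemma \<gamma>_div_le_J: "a \<le> s \<Longrightarrow> \<gamma> / s \<le> real J"
  using J_ge_a a_pos \<gamma>_gt_1 frac_le[of \<gamma> \<gamma> a s] by linarith

lemma step_0: "x \<le> a \<Longrightarrow> ramp ((x - a) / a) = 0"
  using a_pos by (intro ramp_0 divide_nonpos_pos) auto

lemma step_1: "2 * a \<le> x \<Longrightarrow> ramp ((x - a) / a) = 1"
  using a_pos by (intro ramp_1) (simp add: le_divide_eq)

lemma cut_0:
  assumes "x \<le> a \<or> b \<le> x"
  shows "cut x = 0"
  using assms
proof
  assume "x \<le> a"
  then show ?thesis using a_pos step_0[of x] step_0[of "x - 1"] by (simp add: cut_def)
next
  assume "b \<le> x"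
  then show ?thesis using a_pos b_eq step_1[of x] step_1[of "x - 1"] by (simp add: cut_def)
qed

lemma cut_range: "0 \<le> cut x" "cut x \<le> 1"
proof -
  have "ramp ((x - 1 - a) / a) \<le> ramp ((x - a) / a)"
    using a_pos by (intro mono_ramp divide_right_mono) auto
  then show "0 \<le> cut x" by (simp add: cut_def)
  show "cut x \<le> 1"
    using ramp_range[of "(x - a) / a"] ramp_range[of "(x - 1 - a) / a"] by (simp add: cut_def)
qed

lemma cut_partition: "x \<in> {0..1} \<Longrightarrow> cut x + cut (x + 1) = 1"
  using a_pos a_lt step_0[of "x - 1"] step_1[of "x + 1"] by (simp add: cut_def)

lemma C1_cut: "C1 cut"
proof -
  have 1: "cut = (\<lambda>x. ramp (1/a * x + (-1)) - ramp (1/a * x + (- 1 - 1/a)))"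
    using a_pos by (auto simp: cut_def fun_eq_iff field_simps)
  show ?thesis unfolding 1 by (intro C1_diff(1) C1_affine(1) C1_ramp)
qed

lemma C1_square: "C1 (\<lambda>x. x\<^sup>2 / \<gamma>)"
proof (rule C1I(1))
  show "((\<lambda>x. x\<^sup>2 / \<gamma>) has_real_derivative 2 * x / \<gamma>) (at x)" for x
    using \<gamma>_gt_1 by (auto intro!: derivative_eq_intros)
  show "continuous_on UNIV (\<lambda>x. 2 * x / \<gamma>)"
    by (intro continuous_intros) (use \<gamma>_gt_1 in auto)
qed

section \<open>The substitution acting on densities\<close>

lemma sharp_eq: "sharp f x = (\<gamma> / x)\<^sup>2 / \<gamma> * f (\<gamma> / x)"
  using \<gamma>_gt_1 by (simp add: sharp_def power2_eq_square)

lemma sharp_0: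
  assumes "0 < s" "s \<le> t" "\<And>x. x \<le> s \<Longrightarrow> f x = 0" "\<And>x. t \<le> x \<Longrightarrow> f x = 0"
  shows "z \<le> \<gamma> / t \<Longrightarrow> sharp f z = 0" "\<gamma> / s \<le> z \<Longrightarrow> sharp f z = 0"
proof -
  show "sharp f z = 0" if "z \<le> \<gamma> / t"
  \<comment> \<open>For z \<le> 0 also \<gamma> / z \<le> 0, with value 0 at z = 0 by convention,
    and \<open>f\<close> vanishes there because s > 0.\<close>
  proof (cases "z \<le> 0")
    case True
    then have "\<gamma> / z \<le> 0" using \<gamma>_gt_1 by (simp add: divide_nonneg_nonpos)
    then show ?thesis using assms(1,3) by (simp add: sharp_def)
  next
    case False
    then have "t \<le> \<gamma> / z" using that assms by (simp add: field_simps)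
    then show ?thesis using assms(4) by (simp add: sharp_def)
  qed
  show "sharp f z = 0" if "\<gamma> / s \<le> z"
  proof -
    have "0 < \<gamma> / s" using \<gamma>_gt_1 assms(1) by simp
    then have "0 < z" using that by linarith
    then have "\<gamma> / z \<le> s" using that assms(1) by (simp add: field_simps)
    then show ?thesis using assms(3) by (simp add: sharp_def)
  qed
qed

text \<open>The formula is continuous for positive arguments and \<open>sharp f\<close> is 0 to the
  left of \<gamma> / t > 0; these two open sets cover the line, so the pole at 0 does no
  harm.\<close>

lemma continuous_sharp:
  assumes "0 < s" "s \<le> t" "\<And>x. x \<le> s \<Longrightarrow> f x = 0" "\<And>x. t \<le> x \<Longrightarrow> f x = 0"
    and "continuous_on UNIV f"
  shows "continuous_on UNIV (sharp f)"
proof -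
  have "continuous_on {0<..} (sharp f)"
    unfolding sharp_def
    by (intro continuous_intros continuous_on_compose2[OF assms(5)]) auto
  moreover have "continuous_on {..<\<gamma>/t} (sharp f)"
    by (rule continuous_on_eq[of _ "\<lambda>_. 0"]) (auto simp: sharp_0[OF assms(1-4)])
  ultimately have "continuous_on ({0<..} \<union> {..<\<gamma>/t}) (sharp f)"
    by (intro continuous_on_open_Un) auto
  moreover have "{0<..} \<union> {..<\<gamma>/t} = UNIV"
  proof -
    have "0 < \<gamma> / t" using assms(1,2) \<gamma>_gt_1 by simp
    then show ?thesis by fastforce
  qed
  ultimately show ?thesis by simp
qed

lemma deriv_support:
  assumes "C1 f" "\<And>x. x \<le> s \<Longrightarrow> f x = 0" "\<And>x. t \<le> x \<Longrightarrow> f x = 0"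
  shows "x \<le> s \<Longrightarrow> deriv f x = 0" "t \<le> x \<Longrightarrow> deriv f x = 0"
proof -
  show "x \<le> s \<Longrightarrow> deriv f x = 0"
    by (rule C1_deriv_zero[OF assms(1), of "{..<s}"]) (use assms(2) in auto)
  show "t \<le> x \<Longrightarrow> deriv f x = 0"
    by (rule C1_deriv_zero[OF assms(1), of "{t<..}"]) (use assms(3) in auto)
qed

text \<open>Since \<open>sharp f z\<close> equals F (\<gamma> / z) for F x =
  \<open>x\<^sup>2 / \<gamma> * f x\<close>, the chain rule gives an expression that is again an
  image under \<open>sharp\<close>. The factor \<open>x\<^sup>2 / \<gamma>\<close> is the source of
  the contraction.\<close>

lemma C1_sharp:
  assumes "0 < s" "s \<le> t" "\<And>x. x \<le> s \<Longrightarrow> f x = 0" "\<And>x. t \<le> x \<Longrightarrow> f x = 0" "C1 f"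
  shows "C1 (sharp f)" "deriv (sharp f) = (\<lambda>z. - sharp (deriv (\<lambda>x. x\<^sup>2 / \<gamma> * f x)) z)"
proof -
  define F where "F = (\<lambda>x. x\<^sup>2 / \<gamma> * f x)"
  have F: "C1 F" unfolding F_def by (intro C1_mult(1) C1_square assms)
  have D0: "\<And>x. x \<le> s \<Longrightarrow> deriv F x = 0" "\<And>x. t \<le> x \<Longrightarrow> deriv F x = 0"
    using deriv_support[OF F, of s t] assms(3,4) by (auto simp: F_def)
  have sF: "sharp f = (\<lambda>z. F (\<gamma> / z))" by (auto simp: sharp_eq F_def)
  have 1: "(sharp f has_real_derivative - sharp (deriv F) z) (at z)" for z
  proof (cases "0 < z")
    case True
    have "((\<lambda>z. \<gamma> / z) has_real_derivative (- (\<gamma> / z\<^sup>2))) (at z)"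
      using True by (auto intro!: derivative_eq_intros simp: power2_eq_square)
    from C1_chain[OF F this] show ?thesis
      by (simp add: sF sharp_def mult.commute)
  next
    case False
    have "0 < \<gamma> / t" using assms(1,2) \<gamma>_gt_1 by simp
    then have z: "z < \<gamma> / t" using False by linarith
    then have "sharp (deriv F) z = 0" by (intro sharp_0[OF assms(1,2) D0]) auto
    moreover have "(sharp f has_real_derivative 0) (at z)"
      by (rule has_field_derivative_transform_within_open[OF DERIV_const[of 0], of "{..<\<gamma>/t}"])
        (use z sharp_0[OF assms(1-4)] in auto)
    ultimately show ?thesis by simp
  qed
  have 2: "continuous_on UNIV (\<lambda>z. - sharp (deriv F) z)"
    by (intro continuous_intros continuous_sharp[OF assms(1,2) D0] C1_continuous_deriv F)
  show "C1 (sharp f)" "deriv (sharp f) = (\<lambda>z. - sharp (deriv (\<lambda>x. x\<^sup>2 / \<gamma> * f x)) z)"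
    using C1I[OF 1 2] by (simp_all add: F_def)
qed

text \<open>The factor \<open>\<gamma> / z\<^sup>2\<close> is the absolute Jacobian of the
  substitution, so \<open>sharp\<close> preserves the L1 norm.\<close>

lemma integral_abs_sharp:
  assumes "a \<le> s" "s \<le> t" "\<And>x. x \<le> s \<Longrightarrow> f x = 0" "\<And>x. t \<le> x \<Longrightarrow> f x = 0"
    and "continuous_on UNIV f"
  shows "integral {-1..real J} (\<lambda>z. \<bar>sharp f z\<bar>) = integral {s..t} (\<lambda>x. \<bar>f x\<bar>)"
proof -
  have s: "0 < s" using assms(1) a_pos by linarith
  have "integral {-1..real J} (\<lambda>z. \<bar>sharp f z\<bar>) = integral {\<gamma>/t..\<gamma>/s} (\<lambda>z. \<bar>sharp f z\<bar>)"
  proof (rule integral_support)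
    have "0 \<le> \<gamma> / t" using s assms(2) \<gamma>_gt_1 by simp
    then show "{\<gamma>/t..\<gamma>/s} \<subseteq> {-1..real J}" using \<gamma>_div_le_J[OF assms(1)] by auto
  qed (use sharp_0[OF s assms(2-4)] in auto)
  also have "\<dots> = integral {\<gamma>/t..\<gamma>/s} (\<lambda>z. (\<gamma> / z\<^sup>2) *\<^sub>R \<bar>f (\<gamma> / z)\<bar>)"
    using \<gamma>_gt_1 by (simp add: sharp_def abs_mult)
  also have "\<dots> = integral {s..t} (\<lambda>x. \<bar>f x\<bar>)"
    using \<gamma>_gt_1 s assms(2)
    by (intro integral_unique has_integral_inversion[where f = "\<lambda>x. \<bar>f x\<bar>"])
      (auto intro!: continuous_intros continuous_on_subset[OF assms(5)])
  finally show ?thesis .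
qed

section \<open>Periodization\<close>

lemma C1_peri:
  assumes "C1 f"
  shows "C1 (peri f)" "deriv (peri f) = peri (deriv f)"
proof -
  have "C1 (\<lambda>y. f (1 * y + (real j - 1))) \<and>
      deriv (\<lambda>y. f (1 * y + (real j - 1))) = (\<lambda>y. 1 * deriv f (1 * y + (real j - 1)))" for j
    using C1_affine[OF assms, of 1 "real j - 1"] by blast
  then have *: "C1 (\<lambda>y. f (y - 1 + real j))"
      "deriv (\<lambda>y. f (y - 1 + real j)) = (\<lambda>y. deriv f (y - 1 + real j))" for j
    by (simp_all add: algebra_simps)
  show "C1 (peri f)" "deriv (peri f) = peri (deriv f)"
    using C1_sum[of "{..J}" "\<lambda>j y. f (y - 1 + real j)"] *
    by (auto simp: peri_def[abs_def])
qed

lemma continuous_peri: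
  assumes "continuous_on UNIV f"
  shows "continuous_on A (peri f)"
  unfolding peri_def
  by (intro continuous_intros continuous_on_compose2[OF assms]) auto

text \<open>The sums at y + 1 and y differ only by \<open>f (y - 1)\<close> and
  \<open>f (y + real J)\<close>, which lie outside the support.\<close>

lemma per_peri:
  assumes "\<And>x. x \<le> 0 \<Longrightarrow> f x = 0" "\<And>x. real J \<le> x \<Longrightarrow> f x = 0"
  shows "per (peri f)"
  unfolding per_def
proof
  fix y :: real assume y: "y \<in> {0..1}"
  have "peri f (y + 1) + f (y - 1) = (\<Sum>j\<le>Suc J. f (y - 1 + real j))"
    by (subst sum.atMost_Suc_shift) (simp add: peri_def algebra_simps)
  also have "\<dots> = peri f y + f (y + real J)"
    by (simp add: peri_def)
  finally show "peri f (y + 1) = peri f y" using assms y by simp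
qed

lemma integral_abs_peri:
  assumes "continuous_on UNIV f"
  shows "integral {0..1} (\<lambda>y. \<bar>peri f y\<bar>) \<le> integral {-1..real J} (\<lambda>x. \<bar>f x\<bar>)"
proof -
  have c: "continuous_on UNIV (\<lambda>x. \<bar>f x\<bar>)" by (intro continuous_intros assms)
  have cj: "continuous_on A (\<lambda>x. \<bar>f (x - 1 + real j)\<bar>)" for j A
    by (intro continuous_intros continuous_on_compose2[OF assms]) auto
  have "integral {0..1} (\<lambda>y. \<bar>peri f y\<bar>) \<le> integral {0..1} (\<lambda>y. \<Sum>j\<le>J. \<bar>f (y - 1 + real j)\<bar>)"
    by (intro Henstock_Kurzweil_Integration.integral_le integrable_continuous_real
        continuous_intros continuous_peri assms cj)
      (simp add: peri_def sum_abs)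
  also have "\<dots> = (\<Sum>j\<le>J. integral {0..1} (\<lambda>y. \<bar>f (y - 1 + real j)\<bar>))"
    by (intro integral_sum integrable_continuous_real cj) auto
  also have "\<dots> = integral {-1..real J} (\<lambda>x. \<bar>f x\<bar>)"
    by (rule integral_unit_blocks[OF c, symmetric])
  finally show ?thesis .
qed

lemma Var_peri: "C1 f \<Longrightarrow> Var (peri f) \<le> integral {-1..real J} (\<lambda>x. \<bar>deriv f x\<bar>)"
  unfolding Var_def by (simp add: C1_peri integral_abs_peri C1_continuous_deriv)

text \<open>Only the translates y and y + 1, for j = 1 and j = 2, can meet the support of
  \<open>cut\<close>, and there the weights add up to 1.\<close>

lemma peri_cut:
  assumes "per p" "y \<in> {0..1}"
  shows "peri (\<lambda>x. cut x * p x) y = p y"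
proof -
  have "peri (\<lambda>x. cut x * p x) y = (\<Sum>j\<in>{1,2}. cut (y - 1 + real j) * p (y - 1 + real j))"
    unfolding peri_def
  proof (rule sum.mono_neutral_right)
    show "\<forall>j\<in>{..J} - {1, 2}. cut (y - 1 + real j) * p (y - 1 + real j) = 0"
    proof
      fix j assume "j \<in> {..J} - {1, 2}"
      then consider "j = 0" | "j \<ge> 3" by fastforce
      then have "y - 1 + real j \<le> a \<or> b \<le> y - 1 + real j"
        using assms(2) a_pos b_bounds by cases auto
      then show "cut (y - 1 + real j) * p (y - 1 + real j) = 0" by (simp add: cut_0)
    qed
  qed (use J_ge_2 in auto)
  also have "\<dots> = cut y * p y + cut (y + 1) * p (y + 1)"
    by (simp add: add.commute)
  also have "\<dots> = (cut y + cut (y + 1)) * p y"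
    using assms by (simp add: per_def distrib_right)
  finally show ?thesis using cut_partition[OF assms(2)] by simp
qed

section \<open>One application of the transfer operator\<close>

lemma continuous_cut_mult:
  assumes "continuous_on {0..2} p"
  shows "continuous_on UNIV (\<lambda>x. cut x * p x)"
proof -
  \<comment> \<open>Continuity of \<open>p\<close> is known on [0, 2] only; outside [a, b] the
    product is 0.\<close>
  have "continuous_on ({a..b} \<union> ({..a} \<union> {b..})) (\<lambda>x. cut x * p x)"
  proof (rule continuous_on_closed_Un)
    show "continuous_on {a..b} (\<lambda>x. cut x * p x)"
      using a_pos b_bounds
      by (intro continuous_intros C1_continuous C1_cut continuous_on_subset[OF assms]) auto
    show "continuous_on ({..a} \<union> {b..}) (\<lambda>x. cut x * p x)"
      by (rule continuous_on_eq[of _ "\<lambda>_. 0"]) (auto simp: cut_0)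
  qed auto
  moreover have "{a..b} \<union> ({..a} \<union> {b..}) = UNIV" by auto
  ultimately show ?thesis by simp
qed

lemma Q_continuous:
  assumes "continuous_on {0..2} p"
  shows "continuous_on A (Q p)" "per (Q p)"
proof -
  have 0: "\<And>x. x \<le> a \<Longrightarrow> cut x * p x = 0" "\<And>x. b \<le> x \<Longrightarrow> cut x * p x = 0"
    by (simp_all add: cut_0)
  have ab: "0 < a" "a \<le> b" using a_pos a_lt b_bounds by auto
  show "continuous_on A (Q p)" unfolding Q_def
    by (intro continuous_peri continuous_sharp[OF ab 0] continuous_cut_mult assms)
  have "0 \<le> \<gamma> / b" using b_bounds \<gamma>_gt_1 by simp
  then show "per (Q p)"
    unfolding Q_def using sharp_0[OF ab 0] J_ge_a by (intro per_peri) auto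
qed

lemma Q_regular:
  assumes "C1 p"
  shows "C1 (Q p)" "per (Q p)"
proof -
  have f: "C1 (\<lambda>x. cut x * p x)" by (intro C1_mult(1) C1_cut assms)
  have 0: "\<And>x. x \<le> a \<Longrightarrow> cut x * p x = 0" "\<And>x. b \<le> x \<Longrightarrow> cut x * p x = 0"
    by (simp_all add: cut_0)
  have ab: "0 < a" "a \<le> b" using a_pos a_lt b_bounds by auto
  show "C1 (Q p)" unfolding Q_def by (intro C1_peri C1_sharp[OF ab 0 f])
  show "per (Q p)" by (intro Q_continuous C1_continuous assms)
qed

text \<open>\<open>sharp\<close> preserves the L1 norm, periodization does not increase it, and by
  the partition of unity \<open>cut * p\<close> has the same norm as \<open>p\<close>.\<close>

lemma L1_Q:
  assumes "C1 p" "per p"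
  shows "L1 (Q p) \<le> L1 p"
proof -
  define f where "f = (\<lambda>x. cut x * p x)"
  have c: "continuous_on UNIV f"
    unfolding f_def by (intro C1_continuous C1_mult(1) C1_cut assms)
  have 0: "\<And>x. x \<le> a \<Longrightarrow> f x = 0" "\<And>x. b \<le> x \<Longrightarrow> f x = 0"
    by (simp_all add: cut_0 f_def)
  have ab: "0 < a" "a \<le> b" using a_pos a_lt b_bounds by auto
  have "L1 (Q p) \<le> integral {-1..real J} (\<lambda>x. \<bar>sharp f x\<bar>)"
    unfolding L1_def Q_def f_def[symmetric]
    by (intro integral_abs_peri continuous_sharp[OF ab 0 c])
  also have "\<dots> = integral {a..b} (\<lambda>x. \<bar>f x\<bar>)"
    by (rule integral_abs_sharp[OF order_refl ab(2) 0 c])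
  also have "\<dots> = integral {0..2} (\<lambda>x. \<bar>f x\<bar>)"
    by (rule integral_support[symmetric]) (use a_pos b_bounds 0 in auto)
  also have "\<dots> = integral {0..1} (\<lambda>x. \<bar>f x\<bar> + \<bar>f (x + 1)\<bar>)"
    by (intro integral_0_2 continuous_intros c)
  also have "\<dots> = L1 p"
    unfolding L1_def
  proof (rule integral_cong)
    fix x :: real assume x: "x \<in> {0..1}"
    have "\<bar>f x\<bar> + \<bar>f (x + 1)\<bar> = (cut x + cut (x + 1)) * \<bar>p x\<bar>"
      using assms(2) x cut_range by (simp add: f_def abs_mult per_def distrib_right)
    then show "\<bar>f x\<bar> + \<bar>f (x + 1)\<bar> = \<bar>p x\<bar>" using cut_partition[OF x] by simp
  qed
  finally show ?thesis .
qed

text \<open>The contraction factor \<open>b\<^sup>2 / \<gamma> < 1\<close> of the Lasota--Yorke inequality for \<open>Q\<close>.\<close>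

lemma weight_bound:
  assumes "x \<in> {0..1}"
  shows "x\<^sup>2 / \<gamma> * cut x + (x + 1)\<^sup>2 / \<gamma> * cut (x + 1) \<le> b\<^sup>2 / \<gamma>"
proof -
  have *: "y\<^sup>2 * cut y \<le> b\<^sup>2 * cut y" if "0 \<le> y" for y
  proof (cases "y \<le> b")
    case True
    then show ?thesis using that cut_range by (intro mult_right_mono power_mono) auto
  qed (simp add: cut_0)
  have "x\<^sup>2 * cut x + (x + 1)\<^sup>2 * cut (x + 1) \<le> b\<^sup>2 * cut x + b\<^sup>2 * cut (x + 1)"
    using assms by (intro add_mono *) auto
  also have "\<dots> = b\<^sup>2" using cut_partition[OF assms] by (simp flip: distrib_left)
  finally have "(x\<^sup>2 * cut x + (x + 1)\<^sup>2 * cut (x + 1)) / \<gamma> \<le> b\<^sup>2 / \<gamma>"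
    using \<gamma>_gt_1 by (intro divide_right_mono) auto
  then show ?thesis by (simp add: add_divide_distrib)
qed

text \<open>The variation of \<open>Q p\<close> is bounded by the integral of the absolute
  derivative of m p. Its part m p' is controlled by \<open>weight_bound\<close>, its part m' p by
  compactness and the L1 norm.\<close>

lemma Var_Q:
  obtains C where "0 \<le> C"
    "\<And>p. C1 p \<Longrightarrow> per p \<Longrightarrow> Var (Q p) \<le> b\<^sup>2 / \<gamma> * Var p + C * L1 p"
proof -
  define m where "m = (\<lambda>x. x\<^sup>2 / \<gamma> * cut x)"
  have m: "C1 m" unfolding m_def by (intro C1_mult(1) C1_square C1_cut)
  have "compact (deriv m ` {0..2})"
    by (intro compact_continuous_image C1_continuous_deriv m) auto
  then have "bounded (deriv m ` {0..2})" by (rule compact_imp_bounded)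
  then obtain C where C: "\<And>x. x \<in> {0..2} \<Longrightarrow> \<bar>deriv m x\<bar> \<le> C"
    unfolding bounded_iff real_norm_def by blast
  have C0: "0 \<le> C" using C[of 0] by auto
  \<comment> \<open>The points x and x + 1 contribute one C each.\<close>
  have "Var (Q p) \<le> b\<^sup>2 / \<gamma> * Var p + (2 * C) * L1 p" if p: "C1 p" "per p" for p
  proof -
    define f where "f = (\<lambda>x. cut x * p x)"
    have f: "C1 f" unfolding f_def by (intro C1_mult(1) C1_cut p)
    have 0: "\<And>x. x \<le> a \<Longrightarrow> f x = 0" "\<And>x. b \<le> x \<Longrightarrow> f x = 0"
      by (simp_all add: cut_0 f_def)
    have ab: "0 < a" "a \<le> b" using a_pos a_lt b_bounds by auto
    define F where "F = (\<lambda>x. x\<^sup>2 / \<gamma> * f x)"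
    have Fm: "F = (\<lambda>x. m x * p x)" by (simp add: F_def f_def m_def mult.assoc)
    have F: "C1 F" unfolding Fm by (intro C1_mult(1) m p)
    have F0: "\<And>x. x \<le> a \<Longrightarrow> F x = 0" "\<And>x. b \<le> x \<Longrightarrow> F x = 0"
      by (simp_all add: F_def 0)
    note D0 = deriv_support[OF F F0]
    have cD: "continuous_on UNIV (deriv F)" by (rule C1_continuous_deriv[OF F])
    have cont: "continuous_on A (deriv p)" "continuous_on A p" "continuous_on A m" for A
      by (intro C1_continuous_deriv C1_continuous p m)+
    have "Var (Q p) \<le> integral {-1..real J} (\<lambda>x. \<bar>deriv (sharp f) x\<bar>)"
      unfolding Q_def f_def[symmetric] by (intro Var_peri C1_sharp[OF ab 0 f])
    also have "\<dots> = integral {-1..real J} (\<lambda>x. \<bar>sharp (deriv F) x\<bar>)"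
      by (simp add: C1_sharp(2)[OF ab 0 f] F_def)
    also have "\<dots> = integral {a..b} (\<lambda>x. \<bar>deriv F x\<bar>)"
      by (rule integral_abs_sharp[OF order_refl ab(2) D0 cD])
    also have "\<dots> = integral {0..2} (\<lambda>x. \<bar>deriv F x\<bar>)"
      by (rule integral_support[symmetric]) (use a_pos b_bounds D0 in auto)
    also have "\<dots> = integral {0..1} (\<lambda>x. \<bar>deriv F x\<bar> + \<bar>deriv F (x + 1)\<bar>)"
      by (intro integral_0_2 continuous_intros cD)
    also have "\<dots> \<le> integral {0..1} (\<lambda>x. b\<^sup>2 / \<gamma> * \<bar>deriv p x\<bar> + 2 * C * \<bar>p x\<bar>)"
    proof (rule Henstock_Kurzweil_Integration.integral_le)
      show "(\<lambda>x. \<bar>deriv F x\<bar> + \<bar>deriv F (x + 1)\<bar>) integrable_on {0..1}"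
        by (intro integrable_continuous_real continuous_intros continuous_on_compose2[OF cD]) auto
      show "(\<lambda>x. b\<^sup>2 / \<gamma> * \<bar>deriv p x\<bar> + 2 * C * \<bar>p x\<bar>) integrable_on {0..1}"
        by (intro integrable_continuous_real continuous_intros cont)
      fix x :: real assume x: "x \<in> {0..1}"
      have m0: "0 \<le> m y" for y using cut_range \<gamma>_gt_1 by (simp add: m_def)
      have d: "deriv F y = deriv m y * p y + deriv p y * m y" for y
        unfolding Fm using C1_mult(2)[OF m p(1)] by meson
      have e: "\<bar>deriv F y\<bar> \<le> C * \<bar>p y\<bar> + m y * \<bar>deriv p y\<bar>" if "y \<in> {0..2}" for y
      proof -
        have "\<bar>deriv F y\<bar> \<le> \<bar>deriv m y\<bar> * \<bar>p y\<bar> + \<bar>deriv p y\<bar> * m y"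
          unfolding d using m0[of y] by (metis abs_mult abs_of_nonneg abs_triangle_ineq)
        also have "\<bar>deriv m y\<bar> * \<bar>p y\<bar> \<le> C * \<bar>p y\<bar>"
          by (intro mult_right_mono C that) auto
        finally show ?thesis by (simp add: mult.commute)
      qed
      have "\<bar>deriv F x\<bar> + \<bar>deriv F (x + 1)\<bar>
          \<le> (C * \<bar>p x\<bar> + m x * \<bar>deriv p x\<bar>) + (C * \<bar>p x\<bar> + m (x + 1) * \<bar>deriv p x\<bar>)"
        using e[of x] e[of "x + 1"] x p per_deriv[OF p(2,1) x] by (simp add: per_def)
      also have "\<dots> = (m x + m (x + 1)) * \<bar>deriv p x\<bar> + 2 * C * \<bar>p x\<bar>"
        by (simp add: algebra_simps)
      also have "(m x + m (x + 1)) * \<bar>deriv p x\<bar> \<le> b\<^sup>2 / \<gamma> * \<bar>deriv p x\<bar>"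
        using weight_bound[OF x] by (intro mult_right_mono) (auto simp: m_def)
      finally show "\<bar>deriv F x\<bar> + \<bar>deriv F (x + 1)\<bar> \<le> b\<^sup>2 / \<gamma> * \<bar>deriv p x\<bar> + 2 * C * \<bar>p x\<bar>"
        by simp
    qed
    also have "\<dots> = b\<^sup>2 / \<gamma> * Var p + (2 * C) * L1 p"
      unfolding Var_def L1_def
      by (subst integral_add)
        (use \<gamma>_gt_1 in \<open>auto intro!: integrable_continuous_real continuous_intros cont\<close>)
    finally show ?thesis .
  qed
  then show thesis using that[of "2 * C"] C0 by auto
qed

section \<open>Linearity and iterates of the operator\<close>

lemma Q_sum: "Q (\<lambda>x. \<Sum>i\<in>I. c i * f i x) = (\<lambda>y. \<Sum>i\<in>I. c i * Q (f i) y)"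
proof
  fix y
  have "Q (\<lambda>x. \<Sum>i\<in>I. c i * f i x) y = (\<Sum>j\<le>J. \<Sum>i\<in>I.
      c i * sharp (\<lambda>x. cut x * f i x) (y - 1 + real j))"
    by (simp add: Q_def peri_def sharp_def sum_distrib_left mult.left_commute)
  also have "\<dots> = (\<Sum>i\<in>I. c i * Q (f i) y)"
    by (subst sum.swap) (simp add: Q_def peri_def sum_distrib_left)
  finally show "Q (\<lambda>x. \<Sum>i\<in>I. c i * f i x) y = (\<Sum>i\<in>I. c i * Q (f i) y)" .
qed

lemma Q_diff: "Q (\<lambda>x. p x - q x) = (\<lambda>y. Q p y - Q q y)"
  by (simp add: Q_def peri_def sharp_def right_diff_distrib sum_subtractf fun_eq_iff)

lemma Qn_sum: "(Q ^^ n) (\<lambda>x. \<Sum>i\<in>I. c i * f i x) = (\<lambda>y. \<Sum>i\<in>I. c i * (Q ^^ n) (f i) y)"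
  by (induction n) (simp_all add: Q_sum)

lemma Qn_diff: "(Q ^^ n) (\<lambda>x. p x - q x) = (\<lambda>y. (Q ^^ n) p y - (Q ^^ n) q y)"
  by (induction n) (simp_all add: Q_diff)

lemma Q_sums:
  assumes "\<And>x. (\<lambda>k. cut x * f k x) sums (cut x * F x)"
  shows "(\<lambda>k. Q (f k) y) sums Q F y"
  unfolding Q_def peri_def sharp_def by (intro sums_sum sums_mult assms)

text \<open>\<open>Q\<close> is a finite sum of point evaluations weighted by \<open>cut\<close>,
  which is 0 outside [0, 2]; pointwise convergence on that interval is therefore enough.\<close>

lemma Qn_sums:
  assumes "\<And>x. x \<in> {0..2} \<Longrightarrow> (\<lambda>k. f k x) sums F x" "y \<in> {0..2}"
  shows "(\<lambda>k. (Q ^^ n) (f k) y) sums (Q ^^ n) F y"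
  using assms(2)
proof (induction n arbitrary: y)
  case 0
  then show ?case using assms(1) by simp
next
  case (Suc n)
  have "(\<lambda>k. cut x * (Q ^^ n) (f k) x) sums (cut x * (Q ^^ n) F x)" for x
  proof (cases "x \<in> {0..2}")
    case True
    then show ?thesis by (intro sums_mult Suc.IH)
  next
    case False
    then have "cut x = 0" using a_pos b_bounds by (intro cut_0) auto
    then show ?thesis by simp
  qed
  from Q_sums[OF this] show ?case by simp
qed

lemma Qn_regular:
  assumes "C1 p" "per p"
  shows "C1 ((Q ^^ n) p)" "per ((Q ^^ n) p)" "L1 ((Q ^^ n) p) \<le> L1 p"
  using assms by (induction n) (auto intro: Q_regular order.trans[OF L1_Q])

lemma Qn_C1: "C1 p \<Longrightarrow> C1 ((Q ^^ n) p)"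
  by (induction n) (auto intro: Q_regular)

text \<open>The L1 norm never grows, so the L1 errors of successive steps form a geometric series
  bounded independently of n. This uniformity allows \<open>contraction\<close> to fix n before
  M.\<close>

lemma Var_Qn:
  obtains K where "0 \<le> K"
    "\<And>n p. C1 p \<Longrightarrow> per p \<Longrightarrow> Var ((Q ^^ n) p) \<le> (b\<^sup>2 / \<gamma>) ^ n * Var p + K * L1 p"
proof -
  define \<kappa> where "\<kappa> = b\<^sup>2 / \<gamma>"
  have \<kappa>: "0 \<le> \<kappa>" "\<kappa> < 1" using b_sq \<gamma>_gt_1 by (auto simp: \<kappa>_def)
  obtain C where C: "0 \<le> C" "\<And>p. C1 p \<Longrightarrow> per p \<Longrightarrow> Var (Q p) \<le> \<kappa> * Var p + C * L1 p"
    using Var_Q unfolding \<kappa>_def by metis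
  \<comment> \<open>The fixed point of K -> \<kappa> K + C, so that the induction reproduces the
    same constant.\<close>
  define K where "K = C / (1 - \<kappa>)"
  have K: "\<kappa> * K + C = K" using \<kappa> by (simp add: K_def field_simps)
  have "Var ((Q ^^ n) p) \<le> \<kappa> ^ n * Var p + K * L1 p" if p: "C1 p" "per p" for n p
  proof (induction n)
    case 0
    have "0 \<le> K * L1 p" using \<kappa> C(1) L1_nonneg[of p] by (simp add: K_def)
    then show ?case by simp
  next
    case (Suc n)
    have "Var ((Q ^^ Suc n) p) \<le> \<kappa> * Var ((Q ^^ n) p) + C * L1 ((Q ^^ n) p)"
      using C(2)[OF Qn_regular(1,2)[OF p]] by simp
    also have "\<dots> \<le> \<kappa> * (\<kappa> ^ n * Var p + K * L1 p) + C * L1 p"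
      by (intro add_mono mult_left_mono Suc C(1) \<kappa>(1) Qn_regular p)
    also have "\<dots> = \<kappa> ^ Suc n * Var p + (\<kappa> * K + C) * L1 p"
      by (simp add: algebra_simps)
    finally show ?case unfolding K .
  qed
  moreover have "0 \<le> K" using \<kappa> C(1) by (simp add: K_def)
  ultimately show thesis using that[of K] by (simp add: \<kappa>_def)
qed

text \<open>The interpolation error q has Var q \<le> 2 Var p and L1 q \<le> (2 / M) Var p. First n
  makes the factor of Var q less than 1/8, then M > 8 K makes the L1 term small; each contributes at
  most Var p / 4.\<close>

lemma contraction:
  obtains n M where "0 < M"
    "\<And>p. C1 p \<Longrightarrow> per p \<Longrightarrow> Var ((Q ^^ n) (\<lambda>x. p x - interp M p x)) \<le> Var p / 2"
    "\<And>p. C1 p \<Longrightarrow> per p \<Longrightarrow> L1 ((Q ^^ n) (\<lambda>x. p x - interp M p x)) \<le> 2 * Var p"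
proof -
  obtain K where K: "0 \<le> K"
    "\<And>n p. C1 p \<Longrightarrow> per p \<Longrightarrow> Var ((Q ^^ n) p) \<le> (b\<^sup>2 / \<gamma>) ^ n * Var p + K * L1 p"
    using Var_Qn by metis
  have \<kappa>: "0 \<le> b\<^sup>2 / \<gamma>" "b\<^sup>2 / \<gamma> < 1" using b_sq \<gamma>_gt_1 by auto
  obtain n where n: "(b\<^sup>2 / \<gamma>) ^ n < 1 / 8"
    using real_arch_pow_inv[of "1/8" "b\<^sup>2 / \<gamma>"] \<kappa> by auto
  obtain M where M: "8 * K < real M" using reals_Archimedean2 by blast
  have M0: "0 < M" using M K(1) by (cases M) auto
  show thesis
  proof (rule that[OF M0])
    fix p assume p: "C1 p" "per p"
    define q where "q = (\<lambda>x. p x - interp M p x)"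
    have q: "C1 q" "per q"
      unfolding q_def by (intro C1_diff(1) per_diff interp_regular per_interp p M0)+
    have Vq: "Var q \<le> 2 * Var p"
      using Var_diff[OF p(1) interp_regular(1)[of M p]] Var_interp[OF p(1) M0] by (simp add: q_def)
    have Lq: "L1 q \<le> 2 / real M * Var p"
      unfolding q_def by (rule L1_interp[OF p(1) M0])
    have "Var ((Q ^^ n) q) \<le> (b\<^sup>2 / \<gamma>) ^ n * Var q + K * L1 q"
      by (rule K(2)[OF q])
    also have "\<dots> \<le> 1 / 8 * (2 * Var p) + K * (2 / real M * Var p)"
      using n K(1) Vq Lq Var_nonneg by (intro add_mono mult_mono mult_left_mono) auto
    also have "K * (2 / real M * Var p) = (2 * K / real M) * Var p" by simp
    also have "\<dots> \<le> 1 / 4 * Var p"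
      using M M0 Var_nonneg by (intro mult_right_mono) (auto simp: field_simps)
    finally show "Var ((Q ^^ n) (\<lambda>x. p x - interp M p x)) \<le> Var p / 2"
      by (simp add: q_def)
    have "L1 ((Q ^^ n) q) \<le> 2 / real M * Var p"
      using Qn_regular(3)[OF q, of n] Lq by linarith
    also have "\<dots> \<le> 2 * Var p"
      using M0 Var_nonneg by (intro mult_right_mono) (auto simp: field_simps)
    finally show "L1 ((Q ^^ n) (\<lambda>x. p x - interp M p x)) \<le> 2 * Var p"
      by (simp add: q_def)
  qed
qed

section \<open>Solving the equation up to finite rank\<close>

lemma interp_sums:
  assumes "\<And>x. x \<in> {0..2} \<Longrightarrow> (\<lambda>k. f k x) sums F x" "0 < M"
  shows "(\<lambda>k. interp M (f k) x) sums interp M F x"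
proof -
  have node: "real l / real M \<in> {0..2}" if "l \<le> 2 * M" for l
  proof -
    have "real l \<le> real (2 * M)" using that by (rule of_nat_mono)
    then show ?thesis using assms(2) by (auto simp: divide_le_eq)
  qed
  have "(\<lambda>k. (f k (real (Suc l) / real M) - f k (real l / real M)) * ramp (real M * x - real l))
      sums ((F (real (Suc l) / real M) - F (real l / real M)) * ramp (real M * x - real l))"
    if "l < 2 * M" for l
    using that by (intro sums_mult2[OF sums_diff] assms(1) node) auto
  then have "(\<lambda>k. \<Sum>l<2*M. (f k (real (Suc l) / real M) - f k (real l / real M))
      * ramp (real M * x - real l)) sums (\<Sum>l<2*M. (F (real (Suc l) / real M)
      - F (real l / real M)) * ramp (real M * x - real l))"
    by (intro sums_sum) auto
  then show ?thesis
    unfolding interp_def by (intro sums_add assms(1)) auto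
qed

text \<open>\<open>U\<close> is the Neumann series of \<open>p \<mapsto> Q\<^sup>n (p - interp M p)\<close>, a contraction for \<open>Var\<close>.\<close>

lemma resolvent:
  assumes w: "C1 w" "per w" and M: "0 < M"
    and contr: "\<And>p. C1 p \<Longrightarrow> per p \<Longrightarrow> Var ((Q ^^ n) (\<lambda>x. p x - interp M p x)) \<le> Var p / 2"
      "\<And>p. C1 p \<Longrightarrow> per p \<Longrightarrow> L1 ((Q ^^ n) (\<lambda>x. p x - interp M p x)) \<le> 2 * Var p"
  obtains U where "continuous_on {0..2} U" "per U"
    "\<And>x. x \<in> {0..2} \<Longrightarrow> U x = w x + (Q ^^ n) (\<lambda>x. U x - interp M U x) x"
proof -
  define R where "R p = (Q ^^ n) (\<lambda>x. p x - interp M p x)" for p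
  define r where "r k = (R ^^ k) w" for k
  define U where "U x = (\<Sum>k. r k x)" for x
  have r_Suc: "r (Suc k) = R (r k)" for k by (simp add: r_def)
  have R: "C1 (R p)" "per (R p)" if "C1 p" "per p" for p
    unfolding R_def
    by (intro Qn_regular C1_diff(1) per_diff interp_regular per_interp that M)+
  have r: "C1 (r k)" "per (r k)" for k
    by (induction k) (use w in \<open>auto simp: r_def intro: R\<close>)
  have V: "Var (r k) \<le> Var w * (1/2) ^ k" for k
  proof (induction k)
    case (Suc k)
    have "Var (r (Suc k)) \<le> Var (r k) / 2" unfolding r_Suc R_def by (rule contr(1)[OF r])
    then show ?case using Suc by simp
  qed (simp add: r_def)
  define C where "C = 5 * Var w + L1 w"
  \<comment> \<open>The L1 norm at index k is bounded by twice the variation at k - 1, which costs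
    another factor 2; \<open>L1 w\<close> accounts for k = 0.\<close>
  have L: "L1 (r k) \<le> (4 * Var w + L1 w) * (1/2) ^ k" for k
  proof (cases k)
    case 0
    then show ?thesis using Var_nonneg[of w] by (simp add: r_def)
  next
    case (Suc i)
    have "L1 (r k) \<le> 2 * Var (r i)" unfolding Suc r_Suc R_def by (rule contr(2)[OF r])
    also have "\<dots> \<le> 4 * Var w * (1/2) ^ k" using V[of i] Suc by simp
    also have "\<dots> \<le> (4 * Var w + L1 w) * (1/2) ^ k"
      using L1_nonneg[of w] by (intro mult_right_mono) auto
    finally show ?thesis .
  qed
  have bound: "norm (r k x) \<le> C * (1/2) ^ k" if "x \<in> {0..2}" for k x
  proof -
    \<comment> \<open>The sup bound is available on [0, 1]; periodicity carries it to
      [0, 2].\<close>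
    obtain y where y: "y \<in> {0..1}" "r k x = r k y"
    proof (cases "x \<le> 1")
      case True
      then show thesis using that[of x] \<open>x \<in> {0..2}\<close> by auto
    next
      case False
      then have "x - 1 \<in> {0..1}" using \<open>x \<in> {0..2}\<close> by auto
      moreover from this have "r k (x - 1 + 1) = r k (x - 1)" using r(2) unfolding per_def by blast
      ultimately show thesis using that[of "x - 1"] by simp
    qed
    have "norm (r k x) \<le> Var (r k) + L1 (r k)"
      unfolding y(2) real_norm_def by (rule C1_sup_bound[OF r(1) y(1)])
    also have "\<dots> \<le> Var w * (1/2) ^ k + (4 * Var w + L1 w) * (1/2) ^ k"
      by (intro add_mono V L)
    finally show ?thesis by (simp add: C_def algebra_simps)
  qed
  have summ: "summable (\<lambda>k. C * (1/2) ^ k)"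
    by (intro summable_mult summable_geometric) auto
  have sums: "(\<lambda>k. r k x) sums U x" if "x \<in> {0..2}" for x
    unfolding U_def
    by (rule summable_sums, rule summable_comparison_test'[OF summ, of 0]) (rule bound[OF that])
  have ul: "uniform_limit {0..2} (\<lambda>N x. \<Sum>k<N. r k x) U sequentially"
    unfolding U_def by (rule Weierstrass_m_test[OF bound summ])
  have "continuous_on {0..2} (\<lambda>x. \<Sum>k<N. r k x)" for N
    by (intro continuous_on_sum C1_continuous r)
  then have cont: "continuous_on {0..2} U"
    by (intro uniform_limit_theorem[OF _ ul]) simp_all
  have per: "per U"
    using r(2) by (simp add: per_def U_def)
  \<comment> \<open>\<open>U\<close> is only known to be continuous, so the equation is obtained
    termwise: the operator shifts the series by one index.\<close>
  have "U x = w x + (Q ^^ n) (\<lambda>x. U x - interp M U x) x" if x: "x \<in> {0..2}" for x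
  proof -
    have "(\<lambda>k. (Q ^^ n) (\<lambda>x. r k x - interp M (r k) x) x) sums (Q ^^ n) (\<lambda>x. U x - interp M U x) x"
      by (intro Qn_sums sums_diff interp_sums sums M x)
    then have "(\<lambda>k. r (Suc k) x) sums (Q ^^ n) (\<lambda>x. U x - interp M U x) x"
      by (simp add: r_Suc R_def)
    then have "(\<lambda>k. r k x) sums ((Q ^^ n) (\<lambda>x. U x - interp M U x) x + r 0 x)"
      by (rule sums_Suc)
    from sums_unique2[OF this sums[OF x]] show ?thesis by (simp add: r_def)
  qed
  with cont per that show thesis by blast
qed

lemma Qn_continuous:
  assumes "continuous_on {0..2} p" "per p"
  shows "continuous_on {0..2} ((Q ^^ n) p)" "per ((Q ^^ n) p)"
  using assms by (induction n) (auto intro: Q_continuous)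

text \<open>The solution is \<open>p = (1 + Q + \<dots> + Q\<^sup>n\<^sup>-\<^sup>1) U\<close>; the error is the finite-rank term
  \<open>- Q\<^sup>n (interp M U)\<close>.\<close>

lemma finite_cokernel:
  obtains L :: nat and h :: "nat \<Rightarrow> real \<Rightarrow> real"
  where "\<And>l. continuous_on {0..1} (h l)"
    "\<And>w. C1 w \<Longrightarrow> per w \<Longrightarrow> \<exists>p c. continuous_on {0..2} p \<and> per p \<and>
      (\<forall>x\<in>{0..1}. p x - Q p x = w x + (\<Sum>l<L. c l * h l x))"
proof -
  obtain n M where M: "0 < M"
    and contr: "\<And>p. C1 p \<Longrightarrow> per p \<Longrightarrow> Var ((Q ^^ n) (\<lambda>x. p x - interp M p x)) \<le> Var p / 2"
      "\<And>p. C1 p \<Longrightarrow> per p \<Longrightarrow> L1 ((Q ^^ n) (\<lambda>x. p x - interp M p x)) \<le> 2 * Var p"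
    by (rule contraction) (rule that)
  \<comment> \<open>The constant 1 and the 2 M ramps span the range of \<open>interp M\<close>;
    their images under \<open>Q ^^ n\<close> span the error.\<close>
  define e where "e l x = (case l of 0 \<Rightarrow> 1 | Suc l \<Rightarrow> ramp (real M * x - real l))" for l x
  define h where "h l = (Q ^^ n) (e l)" for l
  have "C1 (e l)" for l
  proof (cases l)
    case 0
    then show ?thesis by (simp add: e_def[abs_def] C1_const)
  next
    case (Suc i)
    then show ?thesis
      using C1_affine(1)[OF C1_ramp, of "real M" "- real i"] by (simp add: e_def[abs_def])
  qed
  then have ch: "continuous_on {0..1} (h l)" for l
    unfolding h_def by (intro C1_continuous Qn_C1)
  show thesis
  proof (rule that[of h "Suc (2 * M)", OF ch])
    fix w assume w: "C1 w" "per w"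
    obtain U where U: "continuous_on {0..2} U" "per U"
      "\<And>x. x \<in> {0..2} \<Longrightarrow> U x = w x + (Q ^^ n) (\<lambda>x. U x - interp M U x) x"
      by (rule resolvent[OF w M contr], assumption+) (rule that)
    define d where "d l = (case l of 0 \<Rightarrow> U 0
      | Suc l \<Rightarrow> U (real (Suc l) / real M) - U (real l / real M))" for l
    have EU: "interp M U = (\<lambda>x. \<Sum>l<Suc (2*M). d l * e l x)"
      unfolding sum.lessThan_Suc_shift by (simp add: interp_def[abs_def] d_def e_def)
    \<comment> \<open>The factor 1 gives the sum the form to which \<open>Q_sum\<close>
      applies.\<close>
    define p where "p = (\<lambda>x. \<Sum>k<n. 1 * (Q ^^ k) U x)"
    have "continuous_on {0..2} p"
      unfolding p_def by (intro continuous_intros Qn_continuous U)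
    moreover have "per p"
      using Qn_continuous(2)[OF U(1,2)] by (simp add: per_def p_def)
    moreover have "p x - Q p x = w x + (\<Sum>l<Suc (2*M). (- d l) * h l x)" if "x \<in> {0..1}" for x
    proof -
      have "Q p x = (\<Sum>k<n. (Q ^^ Suc k) U x)"
        unfolding p_def Q_sum by simp
      then have "p x - Q p x = U x - (Q ^^ n) U x"
        using sum_lessThan_telescope'[of "\<lambda>k. (Q ^^ k) U x" n] by (simp add: p_def sum_subtractf)
      also have "\<dots> = w x - (Q ^^ n) (interp M U) x"
        using U(3)[of x] that by (simp add: Qn_diff)
      also have "(Q ^^ n) (interp M U) x = (\<Sum>l<Suc (2*M). d l * h l x)"
        unfolding EU Qn_sum h_def ..
      finally show ?thesis by (simp add: sum_negf)
    qed
    ultimately show "\<exists>p c. continuous_on {0..2} p \<and> per p \<and>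
        (\<forall>x\<in>{0..1}. p x - Q p x = w x + (\<Sum>l<Suc (2 * M). c l * h l x))"
      by (intro exI[of _ p] exI[of _ "\<lambda>l. - d l"]) blast
  qed
qed

end

section \<open>The pairing with integrable functions\<close>

text \<open>Links the Lebesgue integral of the pairing to the gauge integral used so far, for
  functions supported in a compact interval away from 0.\<close>

lemma halfline_integral:
  fixes f :: "real \<Rightarrow> complex"
  assumes "0 < c" "continuous_on {c..d} f" "\<And>x. x \<notin> {c..d} \<Longrightarrow> f x = 0"
  shows "integrable halfline f" "(LINT x|halfline. f x) = integral {c..d} f"
proof -
  have *: "(\<lambda>x. if x \<in> {0<..} then f x else 0) = (\<lambda>x. if x \<in> {c..d} then f x else 0)"
    using assms(1,3) by fastforce
  have "f absolutely_integrable_on {c..d}"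
    by (rule absolutely_integrable_continuous_real[OF assms(2)])
  then have "f absolutely_integrable_on {0<..}"
    unfolding absolutely_integrable_restrict_UNIV[symmetric, of _ f] * .
  then show int: "integrable halfline f"
    by (rule absolutely_integrable_imp_integrable) simp
  have "(LINT x|halfline. f x) = integral {0<..} f"
    by (rule lebesgue_integral_eq_integral[OF int]) simp
  also have "\<dots> = integral UNIV (\<lambda>x. if x \<in> {0<..} then f x else 0)"
    by (simp only: integral_restrict_UNIV)
  also have "\<dots> = integral {c..d} f"
    unfolding * by (simp only: integral_restrict_UNIV)
  finally show "(LINT x|halfline. f x) = integral {c..d} f" .
qed

abbreviation char :: "int \<Rightarrow> real \<Rightarrow> complex"
  where "char m x \<equiv> exp (\<i> * 2 * of_int m * of_real pi * of_real x)"

lemma char_periodic: "char m (x - 1 + real j) = char m x"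
proof -
  have "\<i> * 2 * of_int m * of_real pi * of_real (x - 1 + real j)
      = \<i> * 2 * of_int m * of_real pi * of_real x + 2 * of_real pi * \<i> * of_int (m * (int j - 1))"
    by (simp add: algebra_simps)
  moreover have "exp (2 * of_real pi * \<i> * of_int (m * (int j - 1))) = (1::complex)"
    using exp_integer_2pi[of "of_int (m * (int j - 1))"] by (simp add: mult_ac)
  ultimately show ?thesis by (simp only: exp_add mult_1_right)
qed

lemma linf_pairing_exp_lin:
  assumes "integrable halfline g"
  shows "linf_pairing (exp_lin m) g = (LINT x|halfline. char m x * g x)"
  using assms by transfer simp

text \<open>For \<beta> = 2 \<gamma> the exponentials in 1 / x are exactly the characters composed
  with the involution.\<close>

lemma linf_pairing_exp_inv:
  assumes "integrable halfline g"
  shows "linf_pairing (exp_inv (2 * \<gamma>) n) g = (LINT x|halfline. char n (\<gamma> / x) * g x)"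
  using assms by transfer (simp add: mult_ac)

lemma ess_bounded_mult_integrable:
  assumes "ess_bounded f" "integrable halfline g"
  shows "integrable halfline (\<lambda>x. f x * g x)"
proof -
  obtain C where C: "AE x in halfline. norm (f x) \<le> C"
    using assms(1) by (auto simp: ess_bounded_def)
  show ?thesis
  proof (rule Bochner_Integration.integrable_bound)
    show "integrable halfline (\<lambda>x. C * norm (g x))"
      using assms(2) by (intro integrable_mult_right integrable_norm)
    show "(\<lambda>x. f x * g x) \<in> borel_measurable halfline"
      using assms by (auto simp: ess_bounded_def)
    show "AE x in halfline. norm (f x * g x) \<le> norm (C * norm (g x))"
      using C
    proof eventually_elim
      case (elim x)
      have "norm (f x * g x) \<le> C * norm (g x)"
        unfolding norm_mult using elim by (rule mult_right_mono) simp
      then show ?case by simp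
    qed
  qed
qed

lemma linf_pairing_add: "linf_pairing (f + f') g = linf_pairing f g + linf_pairing f' g"
proof transfer
  fix f f' g :: "real \<Rightarrow> complex"
  assume "linf_eq f f" "linf_eq f' f'"
  then have "ess_bounded f" "ess_bounded f'" by (auto simp: linf_eq_def)
  then show "(if integrable halfline g then LINT x|halfline. (f x + f' x) * g x else 0)
      = (if integrable halfline g then LINT x|halfline. f x * g x else 0)
        + (if integrable halfline g then LINT x|halfline. f' x * g x else 0)"
    by (simp add: distrib_right ess_bounded_mult_integrable)
qed

lemma linf_pairing_scale: "linf_pairing (linf_scale c f) g = c * linf_pairing f g"
proof transfer
  fix c :: complex and f g :: "real \<Rightarrow> complex"
  have "(LINT x|halfline. c * f x * g x) = c * (LINT x|halfline. f x * g x)"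
    unfolding mult.assoc by (rule integral_mult_right_zero)
  then show "(if integrable halfline g then LINT x|halfline. c * f x * g x else 0)
      = c * (if integrable halfline g then LINT x|halfline. f x * g x else 0)"
    by simp
qed

lemma linf_pairing_sum:
  assumes "finite I" "\<And>i. i \<in> I \<Longrightarrow> integrable halfline (g i)"
  shows "linf_pairing f (\<lambda>x. \<Sum>i\<in>I. t i * g i x) = (\<Sum>i\<in>I. linf_pairing f (g i) * t i)"
  using assms
proof transfer
  fix I :: "'a set" and g :: "'a \<Rightarrow> real \<Rightarrow> complex" and f t
  assume I: "finite I" and g: "\<And>i. i \<in> I \<Longrightarrow> integrable halfline (g i)" and "linf_eq f f"
  then have f: "ess_bounded f" by (simp add: linf_eq_def)
  have "(LINT x|halfline. f x * (\<Sum>i\<in>I. t i * g i x)) = (LINT x|halfline. (\<Sum>i\<in>I. f x * g i x * t i))"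
    by (simp add: sum_distrib_left mult_ac)
  also have "\<dots> = (\<Sum>i\<in>I. LINT x|halfline. f x * g i x * t i)"
    by (intro Bochner_Integration.integral_sum integrable_mult_left ess_bounded_mult_integrable f g)
  also have "\<dots> = (\<Sum>i\<in>I. (LINT x|halfline. f x * g i x) * t i)"
    by simp
  finally show "(if integrable halfline (\<lambda>x. \<Sum>i\<in>I. t i * g i x)
        then LINT x|halfline. f x * (\<Sum>i\<in>I. t i * g i x) else 0)
      = (\<Sum>i\<in>I. (if integrable halfline (g i) then LINT x|halfline. f x * g i x else 0) * t i)"
    using g by simp
qed

lemma closedin_annihilator:
  assumes "integrable halfline g"
  shows "closedin weak_star {f. linf_pairing f g = 0}"
proof -
  have "openin weak_star {f. linf_pairing f g \<in> - {0}}"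
    unfolding weak_star_def
    by (rule topology_generated_by_Basis) (use assms open_Compl[of "{0::complex}"] in blast)
  moreover have "UNIV - {f. linf_pairing f g = 0} = {f. linf_pairing f g \<in> - {0}}" by auto
  ultimately show ?thesis by (simp add: closedin_def topspace_weak_star)
qed

lemma subspace_annihilator: "linf.subspace {f. linf_pairing f g = 0}"
proof (rule linf.subspaceI)
  show "0 \<in> {f. linf_pairing f g = 0}"
    using linf_pairing_scale[of 0 0 g] by simp
qed (auto simp: linf_pairing_add linf_pairing_scale)

text \<open>Gaussian elimination: an equation with a nonzero coefficient is used to eliminate one
  unknown from the others, and induction applies to the smaller system.\<close>

lemma homogeneous_system:
  fixes A :: "'e \<Rightarrow> 'i \<Rightarrow> 'a::field"
  assumes "finite E" "finite I" "card E < card I"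
  shows "\<exists>t. (\<exists>i\<in>I. t i \<noteq> 0) \<and> (\<forall>e\<in>E. (\<Sum>i\<in>I. A e i * t i) = 0)"
  using assms
proof (induction E arbitrary: I A rule: finite_induct)
  case empty
  then have "I \<noteq> {}" by auto
  then show ?case by (intro exI[of _ "\<lambda>_. 1"]) auto
next
  case (insert e E)
  show ?case
  proof (cases "\<forall>i\<in>I. A e i = 0")
    case True
    obtain t where t: "\<exists>i\<in>I. t i \<noteq> 0" "\<forall>e\<in>E. (\<Sum>i\<in>I. A e i * t i) = 0"
      using insert.IH[of I A] insert.prems insert.hyps by auto
    then show ?thesis using True by (intro exI[of _ t]) simp
  next
    case False
    then obtain k where k: "k \<in> I" "A e k \<noteq> 0" by blast
    define A' where "A' f i = A f i - A f k * A e i / A e k" for f i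
    have "card E < card (I - {k})" using insert.prems insert.hyps k by simp
    then obtain t where t: "\<exists>i\<in>I-{k}. t i \<noteq> 0" "\<forall>e\<in>E. (\<Sum>i\<in>I-{k}. A' e i * t i) = 0"
      using insert.IH[of "I - {k}" A'] insert.prems by auto
    define s where "s = (\<Sum>i\<in>I-{k}. A e i * t i)"
    \<comment> \<open>Back substitution: equation \<open>e\<close> determines the unknown
      \<open>k\<close>.\<close>
    define u where "u = t(k := - s / A e k)"
    have sum_u: "(\<Sum>i\<in>I. A f i * u i) = (\<Sum>i\<in>I-{k}. A f i * t i) - A f k * s / A e k" for f
    proof -
      have "(\<Sum>i\<in>I. A f i * u i) = A f k * u k + (\<Sum>i\<in>I-{k}. A f i * u i)"
        by (rule sum.remove[OF insert.prems(1) k(1)])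
      also have "(\<Sum>i\<in>I-{k}. A f i * u i) = (\<Sum>i\<in>I-{k}. A f i * t i)"
        by (intro sum.cong) (auto simp: u_def)
      finally show ?thesis by (simp add: u_def)
    qed
    have "(\<Sum>i\<in>I. A f i * u i) = 0" if "f \<in> E" for f
    proof -
      have "(\<Sum>i\<in>I-{k}. A' f i * t i) = (\<Sum>i\<in>I-{k}. A f i * t i) - A f k * s / A e k"
        by (simp add: A'_def s_def left_diff_distrib sum_subtractf sum_distrib_left
            sum_divide_distrib mult.assoc)
      then show ?thesis using t(2) that by (simp add: sum_u)
    qed
    moreover have "(\<Sum>i\<in>I. A e i * u i) = 0"
      unfolding sum_u using k(2) by (simp add: s_def)
    moreover have "\<exists>i\<in>I. u i \<noteq> 0" using t(1) by (auto simp: u_def)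
    ultimately show ?thesis by blast
  qed
qed

section \<open>Annihilators\<close>

context gauss_type_map
begin

text \<open>Characters have period 1, so the integral sees \<open>g\<close> only through its
  periodization. The coefficients \<open>c\<close> are independent of m, so finitely many conditions
  on them cover all frequencies.\<close>

lemma integral_char_peri:
  fixes L :: nat
  assumes "continuous_on UNIV g" "\<And>y. y \<in> {0..1} \<Longrightarrow> peri g y = (\<Sum>l<L. c l * h l y)"
    and "\<And>l. continuous_on {0..1} (h l)"
  shows "integral {-1..real J} (\<lambda>x. char m x * of_real (g x))
    = (\<Sum>l<L. of_real (c l) * integral {0..1} (\<lambda>y. char m y * of_real (h l y)))"
proof -
  have cg: "continuous_on A (\<lambda>x. char m x * of_real (g (x - 1 + real j)))" for A j
    by (intro continuous_intros continuous_on_compose2[OF assms(1)]) auto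
  have "integral {-1..real J} (\<lambda>x. char m x * of_real (g x))
      = (\<Sum>j\<le>J. integral {0..1} (\<lambda>y. char m (y - 1 + real j) * of_real (g (y - 1 + real j))))"
    by (intro integral_unit_blocks continuous_intros assms(1))
  also have "\<dots> = (\<Sum>j\<le>J. integral {0..1} (\<lambda>y. char m y * of_real (g (y - 1 + real j))))"
    by (simp only: char_periodic)
  also have "\<dots> = integral {0..1} (\<lambda>y. \<Sum>j\<le>J. char m y * of_real (g (y - 1 + real j)))"
    by (intro integral_sum[symmetric] integrable_continuous_real cg) auto
  also have "\<dots> = integral {0..1} (\<lambda>y. \<Sum>l<L. of_real (c l) * (char m y * of_real (h l y)))"
  proof (rule integral_cong)
    fix y :: real assume "y \<in> {0..1}"
    have "(\<Sum>j\<le>J. char m y * of_real (g (y - 1 + real j))) = char m y * of_real (peri g y)"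
      by (simp add: peri_def sum_distrib_left)
    also have "\<dots> = (\<Sum>l<L. of_real (c l) * (char m y * of_real (h l y)))"
      by (simp add: assms(2)[OF \<open>y \<in> {0..1}\<close>] sum_distrib_left mult.left_commute)
    finally show "(\<Sum>j\<le>J. char m y * of_real (g (y - 1 + real j)))
      = (\<Sum>l<L. of_real (c l) * (char m y * of_real (h l y)))" .
  qed
  also have "\<dots> = (\<Sum>l<L. integral {0..1} (\<lambda>y. of_real (c l) * (char m y * of_real (h l y))))"
    by (intro integral_sum integrable_continuous_real continuous_intros assms(3)) simp
  finally show ?thesis by simp
qed

text \<open>The window [sqrt \<gamma>, \<gamma> / b] for the free bump starts at the fixed point of
  the involution and lies beyond the support of \<open>cut\<close>; its mirror image is
  [b, sqrt \<gamma>].\<close>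

lemma sqrt_\<gamma>: "b < sqrt \<gamma>" "sqrt \<gamma> < \<gamma> / b" "\<gamma> / sqrt \<gamma> = sqrt \<gamma>"
proof -
  show 1: "b < sqrt \<gamma>" by (rule real_less_rsqrt[OF b_sq])
  show 2: "\<gamma> / sqrt \<gamma> = sqrt \<gamma>" using \<gamma>_gt_1 by (simp add: real_div_sqrt)
  have "\<gamma> / sqrt \<gamma> < \<gamma> / b"
    using 1 b_bounds \<gamma>_gt_1 by (intro divide_strict_left_mono mult_pos_pos) auto
  then show "sqrt \<gamma> < \<gamma> / b" unfolding 2 .
qed

text \<open>The witness is \<open>g = A - sharp A\<close> with \<open>A = cut * p + e\<close>, whose periodization on \<open>[0, 1]\<close>
  is \<open>p - Q p - w\<close> with \<open>w = peri (sharp e) - peri e\<close>.\<close>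

lemma almost_annihilator:
  fixes L :: nat
  assumes h: "\<And>l. continuous_on {0..1} (h l)"
    and coker: "\<And>w. C1 w \<Longrightarrow> per w \<Longrightarrow> \<exists>p c. continuous_on {0..2} p \<and> per p \<and>
      (\<forall>x\<in>{0..1}. p x - Q p x = w x + (\<Sum>l<L. c l * h l x))"
    and e: "C1 e" "\<And>x. x \<le> sqrt \<gamma> \<Longrightarrow> e x = 0" "\<And>x. \<gamma> / b \<le> x \<Longrightarrow> e x = 0"
  obtains g c where "continuous_on UNIV g" "\<And>x. x \<le> a \<Longrightarrow> g x = 0" "\<And>x. \<gamma> / a \<le> x \<Longrightarrow> g x = 0"
    "\<And>x. x \<in> {sqrt \<gamma>..\<gamma> / b} \<Longrightarrow> g x = e x" "\<And>x. 0 < x \<Longrightarrow> sharp g x = - g x"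
    "\<And>y. y \<in> {0..1} \<Longrightarrow> peri g y = (\<Sum>l<L. c l * h l y)"
proof -
  have ab: "0 < a" "a \<le> b" using a_pos a_lt b_bounds by auto
  have ba: "\<gamma> / b \<le> \<gamma> / a" using ab \<gamma>_gt_1 b_bounds by (intro divide_left_mono) auto
  have s: "0 < sqrt \<gamma>" "sqrt \<gamma> \<le> \<gamma> / b" using \<gamma>_gt_1 sqrt_\<gamma> by auto
  note se0 = sharp_0[OF s e(2,3)]
  have bb: "\<gamma> / (\<gamma> / b) = b" using \<gamma>_gt_1 by simp
  define w where "w y = peri (sharp e) y - peri e y" for y
  have w: "C1 w" "per w"
  proof -
    show "C1 w" unfolding w_def[abs_def]
      by (intro C1_diff(1) C1_peri(1) C1_sharp[OF s e(2,3,1)] e)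
    have "per (peri (sharp e))"
    proof (rule per_peri)
      show "sharp e x = 0" if "x \<le> 0" for x
      proof (rule se0(1))
        show "x \<le> \<gamma> / (\<gamma> / b)" unfolding bb using that b_bounds by linarith
      qed
      show "sharp e x = 0" if "real J \<le> x" for x
      proof (rule se0(2))
        show "\<gamma> / sqrt \<gamma> \<le> x"
          unfolding sqrt_\<gamma>(3) using that sqrt_\<gamma>(2) ba J_ge_a by linarith
      qed
    qed
    moreover have "per (peri e)"
    proof (rule per_peri)
      show "e x = 0" if "x \<le> 0" for x using that s(1) by (intro e(2)) linarith
      show "e x = 0" if "real J \<le> x" for x using that ba J_ge_a by (intro e(3)) linarith
    qed
    ultimately show "per w" unfolding w_def[abs_def] by (rule per_diff)
  qed
  obtain p c where p: "continuous_on {0..2} p" "per p"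
    "\<And>x. x \<in> {0..1} \<Longrightarrow> p x - Q p x = w x + (\<Sum>l<L. c l * h l x)"
    using coker[OF w] by blast
  define A where "A x = cut x * p x + e x" for x
  have A: "continuous_on UNIV A"
    unfolding A_def by (intro continuous_intros continuous_cut_mult p C1_continuous e)
  have A0: "A x = 0" if "x \<le> a" for x
    using that e(2)[of x] cut_0[of x] ab sqrt_\<gamma> by (simp add: A_def)
  have A1: "A x = 0" if "\<gamma> / b \<le> x" for x
    using that e(3)[of x] cut_0[of x] sqrt_\<gamma> by (simp add: A_def)
  have ag: "a \<le> \<gamma> / b" using ab sqrt_\<gamma> by linarith
  have sA0: "z \<le> b \<Longrightarrow> sharp A z = 0" "\<gamma> / a \<le> z \<Longrightarrow> sharp A z = 0" for z
    using sharp_0[of a "\<gamma> / b" A z, OF ab(1) ag A0 A1] unfolding bb by blast+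
  define g where "g x = A x - sharp A x" for x
  show thesis
  proof (rule that[of g c])
    show "continuous_on UNIV g"
      unfolding g_def by (intro continuous_intros A continuous_sharp[OF ab(1) ag A0 A1])
    show "g x = 0" if "x \<le> a" for x
      using that ab A0[of x] sA0(1)[of x] by (simp add: g_def)
    show "g x = 0" if "\<gamma> / a \<le> x" for x
      using that ba A1[of x] sA0(2)[of x] by (simp add: g_def)
    \<comment> \<open>The mirror point \<gamma> / x lies in [b, sqrt \<gamma>], between the support
      of \<open>cut\<close> and that of \<open>e\<close>, so \<open>sharp A\<close> vanishes at
      x.\<close>
    show "g x = e x" if x: "x \<in> {sqrt \<gamma>..\<gamma> / b}" for x
    proof -
      have x0: "0 < x" using x s(1) unfolding atLeastAtMost_iff by linarith
      have "\<gamma> / x \<le> sqrt \<gamma>"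
        using x \<gamma>_gt_1 divide_left_mono[of "sqrt \<gamma>" x \<gamma>] mult_pos_pos[OF x0 s(1)]
        unfolding sqrt_\<gamma>(3) by auto
      moreover have "b \<le> \<gamma> / x"
        using x x0 b_bounds by (simp add: field_simps)
      ultimately have "A (\<gamma> / x) = 0" by (simp add: A_def cut_0 e(2))
      moreover have "cut x = 0" using x sqrt_\<gamma>(1) by (intro cut_0) auto
      ultimately show ?thesis by (simp add: g_def sharp_def A_def)
    qed
    \<comment> \<open>\<open>sharp\<close> is an involution for positive arguments, so
      \<open>A - sharp A\<close> is antisymmetric.\<close>
    show "sharp g x = - g x" if "0 < x" for x
      using that \<gamma>_gt_1 by (simp add: g_def sharp_def right_diff_distrib power2_eq_square)
    fix y :: real assume y: "y \<in> {0..1}"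
    have "peri A y = p y + peri e y"
      using peri_cut[OF p(2) y] by (simp add: A_def peri_def sum.distrib)
    moreover have "peri (sharp A) y = Q p y + peri (sharp e) y"
      by (simp add: A_def[abs_def] Q_def peri_def sharp_def distrib_left sum.distrib)
    ultimately have "peri g y = p y - Q p y - w y"
      by (simp add: g_def[abs_def] peri_def sum_subtractf w_def)
    then show "peri g y = (\<Sum>l<L. c l * h l y)" using p(3)[OF y] by simp
  qed
qed

text \<open>The substitution x -> \<gamma> / x together with antisymmetry exchanges the two kinds of
  exponentials up to sign, so one family of integrals decides both.\<close>

lemma pairing_exponentials:
  assumes "continuous_on UNIV g" "\<And>x. x \<le> a \<Longrightarrow> g x = 0" "\<And>x. \<gamma> / a \<le> x \<Longrightarrow> g x = 0"
    and anti: "\<And>x. 0 < x \<Longrightarrow> sharp g x = - g x"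
  defines "G \<equiv> \<lambda>x. complex_of_real (g x)"
  shows "integrable halfline G"
    "linf_pairing (exp_lin m) G = integral {-1..real J} (\<lambda>x. char m x * G x)"
    "linf_pairing (exp_inv (2 * \<gamma>) m) G = - integral {-1..real J} (\<lambda>x. char m x * G x)"
proof -
  have "a * a < 1" using a_pos a_lt mult_strict_mono[of a 1 a 1] by simp
  then have ag: "a \<le> \<gamma> / a" using a_pos \<gamma>_gt_1 by (simp add: field_simps)
  have G: "continuous_on A G" for A
    unfolding G_def by (intro continuous_intros continuous_on_subset[OF assms(1)]) auto
  have G0: "G x = 0" if "x \<le> a \<or> \<gamma> / a \<le> x" for x
    using that assms(2,3) by (auto simp: G_def)
  have out: "G x = 0" if "x \<notin> {a..\<gamma>/a}" for x using that by (intro G0) auto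
  show int: "integrable halfline G"
    by (rule halfline_integral(1)[OF a_pos G]) (use out in auto)
  have block: "integral {-1..real J} (\<lambda>x. char m x * G x) = integral {a..\<gamma>/a} (\<lambda>x. char m x * G x)"
    by (rule integral_support) (use a_pos J_ge_a G0 in auto)
  have "linf_pairing (exp_lin m) G = integral {a..\<gamma>/a} (\<lambda>x. char m x * G x)"
    unfolding linf_pairing_exp_lin[OF int]
    by (rule halfline_integral(2)[OF a_pos]) (auto intro!: continuous_intros G simp: out)
  then show "linf_pairing (exp_lin m) G = integral {-1..real J} (\<lambda>x. char m x * G x)"
    by (simp add: block)
  have "linf_pairing (exp_inv (2 * \<gamma>) m) G = integral {a..\<gamma>/a} (\<lambda>x. char m (\<gamma> / x) * G x)"
    unfolding linf_pairing_exp_inv[OF int]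
    by (rule halfline_integral(2)[OF a_pos])
      (use a_pos in \<open>auto intro!: continuous_intros G simp: out\<close>)
  also have "\<dots> = - integral {a..\<gamma>/a} (\<lambda>z. (\<gamma> / z\<^sup>2) *\<^sub>R (char m (\<gamma> / z) * G (\<gamma> / z)))"
    unfolding integral_neg[symmetric]
  proof (rule integral_cong)
    fix z assume "z \<in> {a..\<gamma>/a}"
    then have "0 < z" using a_pos by auto
    then have "G z = - of_real (\<gamma> / z\<^sup>2 * g (\<gamma> / z))"
      using anti[of z] unfolding G_def sharp_def of_real_minus[symmetric] by simp
    then show "char m (\<gamma> / z) * G z = - ((\<gamma> / z\<^sup>2) *\<^sub>R (char m (\<gamma> / z) * G (\<gamma> / z)))"
      by (simp add: G_def scaleR_conv_of_real)
  qed
  also have "integral {a..\<gamma>/a} (\<lambda>z. (\<gamma> / z\<^sup>2) *\<^sub>R (char m (\<gamma> / z) * G (\<gamma> / z)))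
      = integral {a..\<gamma>/a} (\<lambda>x. char m x * G x)"
  proof (rule integral_unique)
    have "((\<lambda>z. (\<gamma> / z\<^sup>2) *\<^sub>R (char m (\<gamma> / z) * G (\<gamma> / z))) has_integral
        integral {a..\<gamma>/a} (\<lambda>x. char m x * G x)) {\<gamma> / (\<gamma> / a)..\<gamma> / a}"
      using \<gamma>_gt_1 a_pos ag
      by (intro has_integral_inversion[where f = "\<lambda>x. char m x * G x"] continuous_intros G) auto
    then show "((\<lambda>z. (\<gamma> / z\<^sup>2) *\<^sub>R (char m (\<gamma> / z) * G (\<gamma> / z))) has_integral
        integral {a..\<gamma>/a} (\<lambda>x. char m x * G x)) {a..\<gamma> / a}"
      using \<gamma>_gt_1 by simp
  qed
  finally show "linf_pairing (exp_inv (2 * \<gamma>) m) G = - integral {-1..real J} (\<lambda>x. char m x * G x)"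
    by (simp add: block)
qed

text \<open>If finitely many cosets, those of \<open>B\<close>, spanned the quotient, take
  \<open>L + card B + 1\<close> almost annihilators built from disjoint bumps. Some nontrivial
  combination has zero periodization on [0, 1] and annihilates \<open>B\<close>, hence annihilates
  everything, although it does not vanish on the bumps.\<close>

lemma infinite_codimension_N_space:
  "infinite_codimension (weak_star closure_of N_space (2 * \<gamma>))"
  unfolding infinite_codimension_def
proof
  assume "\<exists>B. finite B \<and> (\<forall>f. \<exists>g\<in>linf.span B. f - g \<in> weak_star closure_of N_space (2 * \<gamma>))"
  then obtain B where B: "finite B"
    and cover: "\<And>f. \<exists>g\<in>linf.span B. f - g \<in> weak_star closure_of N_space (2 * \<gamma>)"
    by blast
  obtain h :: "nat \<Rightarrow> real \<Rightarrow> real" and L :: nat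
    where h: "\<And>l. continuous_on {0..1} (h l)"
    and coker: "\<And>w. C1 w \<Longrightarrow> per w \<Longrightarrow> \<exists>p c. continuous_on {0..2} p \<and> per p \<and>
      (\<forall>x\<in>{0..1}. p x - Q p x = w x + (\<Sum>l<L. c l * h l x))"
    by (rule finite_cokernel) (rule that)
  define T where "T = L + card B + 1"
  define d where "d = (\<gamma> / b - sqrt \<gamma>) / real T"
  define u where "u i = sqrt \<gamma> + real i * d" for i :: nat
  define e where "e i = bump (u i) (u (Suc i))" for i
  have T0: "0 < real T" by (simp add: T_def)
  have d0: "0 < d" using sqrt_\<gamma>(2) T0 by (simp add: d_def)
  have u_mono: "i \<le> j \<Longrightarrow> u i \<le> u j" for i j using d0 by (simp add: u_def)
  have u_0: "u 0 = sqrt \<gamma>" and u_T: "u T = \<gamma> / b" using T0 by (simp_all add: u_def d_def)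
  have e0: "e i x = 0" if "x \<le> u i \<or> u (Suc i) \<le> x" for i x
    unfolding e_def by (rule bump_0[OF that])
  define ann where "ann i g c \<longleftrightarrow> continuous_on UNIV g \<and> (\<forall>x\<le>a. g x = 0) \<and>
      (\<forall>x\<ge>\<gamma>/a. g x = 0) \<and> (\<forall>x\<in>{sqrt \<gamma>..\<gamma> / b}. g x = e i x) \<and>
      (\<forall>x>0. sharp g x = - g x) \<and> (\<forall>y\<in>{0..1}. peri g y = (\<Sum>l<L. c l * h l y))" for i g c
  have "\<exists>g c. ann i g c" if "i < T" for i
  proof -
    have le: "e i x = 0" if "x \<le> sqrt \<gamma>" for x
      using that u_mono[of 0 i] by (intro e0) (simp add: u_0)
    have ge: "e i x = 0" if "\<gamma> / b \<le> x" for x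
      using that u_mono[of "Suc i" T] \<open>i < T\<close> by (intro e0) (simp add: u_T)
    have C1e: "C1 (e i)" unfolding e_def by (rule C1_bump)
    show ?thesis
      unfolding ann_def
      by (rule almost_annihilator[where h = h and L = L and e = "e i", OF h coker C1e le ge]) blast+
  qed
  then obtain g c where ann: "\<And>i. i < T \<Longrightarrow> ann i (g i) (c i)"
    by metis
  have g: "continuous_on UNIV (g i)"
    and g0: "x \<le> a \<Longrightarrow> g i x = 0" "\<gamma> / a \<le> x \<Longrightarrow> g i x = 0"
    and ge: "x \<in> {sqrt \<gamma>..\<gamma> / b} \<Longrightarrow> g i x = e i x"
    and anti: "0 < x \<Longrightarrow> sharp (g i) x = - g i x"
    and per_g: "y \<in> {0..1} \<Longrightarrow> peri (g i) y = (\<Sum>l<L. c i l * h l y)"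
    if "i < T" for i x y
    using ann[OF that] unfolding ann_def by blast+
  define G where "G i = (\<lambda>x. complex_of_real (g i x))" for i
  define \<nu> where "\<nu> m l = integral {0..1} (\<lambda>y. char m y * of_real (h l y))" for m l
  have pair: "integrable halfline (G i)"
      "linf_pairing (exp_lin m) (G i) = (\<Sum>l<L. of_real (c i l) * \<nu> m l)"
      "linf_pairing (exp_inv (2 * \<gamma>) m) (G i) = - (\<Sum>l<L. of_real (c i l) * \<nu> m l)"
    if "i < T" for i m
    using pairing_exponentials[OF g[OF that] g0(1)[OF that] g0(2)[OF that] anti[OF that]]
      integral_char_peri[OF g[OF that] per_g[OF that] h, of m]
    by (simp_all add: G_def \<nu>_def)
  \<comment> \<open>\<open>Inl l\<close> is the condition that the combined coefficient of
    \<open>h l\<close> vanishes, \<open>Inr f\<close> that \<open>f\<close> is annihilated.\<close>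
  define A where "A q i = (case q of Inl l \<Rightarrow> of_real (c i l) | Inr f \<Rightarrow> linf_pairing f (G i))"
    for q :: "nat + linf" and i
  have "card ({..<L} <+> B) < card {..<T}"
    using B by (simp add: card_Plus T_def)
  then obtain t where t: "\<exists>i\<in>{..<T}. t i \<noteq> 0" "\<And>q. q \<in> {..<L} <+> B \<Longrightarrow> (\<Sum>i<T. A q i * t i) = 0"
    using homogeneous_system[of "{..<L} <+> B" "{..<T}" A] B by auto
  have tc: "(\<Sum>i<T. of_real (c i l) * t i) = 0" if "l < L" for l
    using t(2)[of "Inl l"] that by (simp add: A_def InlI)
  have tB: "(\<Sum>i<T. linf_pairing f (G i) * t i) = 0" if "f \<in> B" for f
    using t(2)[of "Inr f"] that by (simp add: A_def InrI)
  define F where "F = (\<lambda>x. \<Sum>i<T. t i * G i x)"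
  have F: "integrable halfline F"
    unfolding F_def by (intro Bochner_Integration.integrable_sum integrable_mult_right pair(1)) auto
  have pair_F: "linf_pairing f F = (\<Sum>i<T. linf_pairing f (G i) * t i)" for f
    unfolding F_def by (rule linf_pairing_sum) (auto intro: pair(1))
  have zero: "(\<Sum>i<T. (\<Sum>l<L. of_real (c i l) * \<nu> m l) * t i) = 0" for m
  proof -
    have "(\<Sum>i<T. (\<Sum>l<L. of_real (c i l) * \<nu> m l) * t i)
        = (\<Sum>l<L. \<nu> m l * (\<Sum>i<T. of_real (c i l) * t i))"
      by (simp only: sum_distrib_left sum_distrib_right) (subst sum.swap, simp add: mult_ac)
    then show ?thesis by (simp add: tc)
  qed
  define Z where "Z = {f. linf_pairing f F = 0}"
  have Z: "linf.subspace Z" unfolding Z_def by (rule subspace_annihilator)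
  have "linf_pairing (exp_lin m) F = 0" for m
    using zero[of m] by (simp add: pair_F pair(2))
  moreover have "linf_pairing (exp_inv (2 * \<gamma>) m) F = 0" for m
    using zero[of m] by (simp add: pair_F pair(3) sum_negf)
  ultimately have "N_space (2 * \<gamma>) \<subseteq> Z"
    unfolding N_space_def by (intro linf.span_minimal Z) (auto simp: Z_def)
  then have closure: "weak_star closure_of N_space (2 * \<gamma>) \<subseteq> Z"
    unfolding Z_def by (rule closure_of_minimal[OF _ closedin_annihilator[OF F]])
  have "linf.span B \<subseteq> Z"
    by (intro linf.span_minimal Z) (auto simp: Z_def pair_F tB)
  \<comment> \<open>Every \<open>f\<close> is the sum of an element of the closure and an element of
    the span of \<open>B\<close>, both inside \<open>Z\<close>.\<close>
  then have all: "f \<in> Z" for f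
    using cover[of f] closure linf.subspace_add[OF Z, of "f - f'" f' for f'] by fastforce
  obtain j where j: "j < T" "t j \<noteq> 0" using t(1) by auto
  \<comment> \<open>Tested on bump j, the combination keeps only its term with \<open>t j\<close>:
    on the window \<open>g i\<close> is bump i, and distinct bumps meet at most at
    endpoints.\<close>
  define E where "E = (\<lambda>x. complex_of_real (e j x))"
  have C1e: "C1 (e i)" for i unfolding e_def by (rule C1_bump)
  have uj: "u j < u (Suc j)" "0 < u j" using d0 \<gamma>_gt_1 by (simp_all add: u_def add_pos_nonneg)
  have E: "linf_eq E E"
  proof -
    obtain C where C: "\<And>x. x \<in> {u j..u (Suc j)} \<Longrightarrow> \<bar>e j x\<bar> \<le> C"
    proof -
      have "bounded (e j ` {u j..u (Suc j)})"
        by (intro compact_imp_bounded compact_continuous_image C1_continuous C1e) auto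
      then show thesis using that unfolding bounded_iff real_norm_def by blast
    qed
    have "norm (E x) \<le> max 0 C" for x
      using C[of x] e0[of x j] by (cases "x \<in> {u j..u (Suc j)}") (auto simp: E_def)
    moreover have "E \<in> borel_measurable halfline"
      unfolding E_def
      by (intro continuous_imp_measurable_on_sets_lebesgue continuous_intros C1_continuous C1e) auto
    ultimately show ?thesis
      by (auto simp: linf_eq_def intro: ess_bounded_bounded)
  qed
  have "linf_pairing (abs_linf E) (G i) = (if i = j then of_real (integral {u j..u (Suc j)} (\<lambda>x. (e j x)\<^sup>2)) else 0)"
    if i: "i < T" for i
  proof -
    have "linf_pairing (abs_linf E) (G i) = (LINT x|halfline. E x * G i x)"
      using pair(1)[OF i] by (simp add: linf_pairing.abs_eq E)
    also have "\<dots> = integral {u j..u (Suc j)} (\<lambda>x. E x * G i x)"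
    proof (rule halfline_integral(2)[OF uj(2)])
      show "continuous_on {u j..u (Suc j)} (\<lambda>x. E x * G i x)"
        unfolding E_def G_def
        by (intro continuous_intros C1_continuous C1e continuous_on_subset[OF g[OF i]]) auto
      show "E x * G i x = 0" if "x \<notin> {u j..u (Suc j)}" for x
        using that e0[of x j] by (auto simp: E_def)
    qed
    also have "\<dots> = integral {u j..u (Suc j)} (\<lambda>x. of_real (if i = j then (e j x)\<^sup>2 else 0))"
    proof (rule integral_cong)
      fix x assume x: "x \<in> {u j..u (Suc j)}"
      then have "x \<in> {sqrt \<gamma>..\<gamma> / b}"
        using u_mono[of 0 j] u_mono[of "Suc j" T] j by (simp add: u_0 u_T)
      then have "G i x = of_real (e i x)" by (simp add: G_def ge[OF i])
      moreover have "e i x = 0" if "i \<noteq> j"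
      proof (rule e0)
        show "x \<le> u i \<or> u (Suc i) \<le> x"
        proof (cases "i < j")
          case True
          then show ?thesis using x u_mono[of "Suc i" j] by simp
        next
          case False
          then show ?thesis using that x u_mono[of "Suc j" i] by simp
        qed
      qed
      ultimately show "E x * G i x = of_real (if i = j then (e j x)\<^sup>2 else 0)"
        by (simp add: E_def power2_eq_square)
    qed
    also have "\<dots> = (if i = j then of_real (integral {u j..u (Suc j)} (\<lambda>x. (e j x)\<^sup>2)) else 0)"
    proof -
      have "(\<lambda>x. (e j x)\<^sup>2) integrable_on {u j..u (Suc j)}"
        by (intro integrable_continuous_real continuous_intros C1_continuous C1e)
      from has_integral_of_real[OF integrable_integral[OF this], where 'b = complex]
      show ?thesis by (auto simp del: of_real_power dest: integral_unique)
    qed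
    finally show ?thesis .
  qed
  then have "linf_pairing (abs_linf E) F = of_real (integral {u j..u (Suc j)} (\<lambda>x. (e j x)\<^sup>2)) * t j"
    using j(1) by (simp add: pair_F if_distrib[of "\<lambda>z. z * _"] cong: if_cong)
  moreover have "linf_pairing (abs_linf E) F = 0" using all by (auto simp: Z_def)
  ultimately show False
    using integral_bump_sq[OF uj(1)] j(2) by (simp add: e_def)
qed

end

theorem theorem1p4:
  fixes \<beta> :: real
  assumes "\<beta> > 2"
  shows "infinite_codimension (weak_star closure_of N_space \<beta>)"
proof -
  define \<gamma> where "\<gamma> = \<beta> / 2"
  have \<gamma>: "1 < \<gamma>" using assms by (simp add: \<gamma>_def)
  \<comment> \<open>There is room above 1 because \<gamma> > 1, which is where \<beta> > 2
    enters.\<close>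
  obtain b where b: "1 < b" "b < min 2 (sqrt \<gamma>)"
    using dense[of 1 "min 2 (sqrt \<gamma>)"] \<gamma> by auto
  have "b\<^sup>2 < \<gamma>"
    using b real_less_rsqrt[of b \<gamma>] power_strict_mono[of b "sqrt \<gamma>" 2] \<gamma> by simp
  moreover obtain J where "\<gamma> / ((b - 1) / 2) \<le> real J"
    using real_arch_simple by blast
  ultimately interpret gauss_type_map \<gamma> b J
    using b by unfold_locales auto
  show ?thesis using infinite_codimension_N_space by (simp add: \<gamma>_def)
qed

end
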